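(* Assume that $\mathfrak b=\mathfrak d$. Let $S$ be a semifilter. The following assertions are equivalent: (1) The semifilter $S$ is nonmeager. (2) There are an $S$-scale $X\subseteq[\mathbb N]^\infty$ and a $\mathfrak d$-concentrated real set $Y$ such that the product space $(X\cup[\mathbb N]^{<\infty})\times Y$ is not Menger.
   Context: $\mathbb N=\{1,2,\dots\}$. The family $P(\mathbb N)$ of all subsets of $\mathbb N$ is identified with the Cantor space $\{0,1\}^{\mathbb N}$, with its topology; $[\mathbb N]^{\infty}$ and $[\mathbb N]^{<\infty}$ are the subspaces of infinite and of finite subsets of $\mathbb N$, respectively. Each $a\in[\mathbb N]^\infty$ is identified with its increasing enumeration: $a(n)$ is the $n$-th element of $a$. A real set is a set of real numbers with the subspace topology; subspaces of $P(\mathbb N)$ are regarded as real sets. For sets $a,b$, $a\subseteq^* b$ means $a\setminus b$ is finite. A semifilter is a nonempty set $S\subseteq[\mathbb N]^\infty$ such that $s\in S$, $b\in[\mathbb N]^\infty$ and $s\subseteq^* b$ imply $b\in S$. It is (non)meager if it is (non)meager as a subset of the space $P(\mathbb N)$. Let $S^+=\{a\in[\mathbb N]^\infty:\mathbb N\setminus a\notin S\}$ (again a semifilter unless empty). For $a,b\in[\mathbb N]^\infty$ let $[a\le b]=\{n: a(n)\le b(n)\}$, and for $R\subseteq[\mathbb N]^\infty$ write $a\le_R b$ if $[a\le b]\in R$. $\mathfrak b(S)$ is the minimal cardinality of a subset of $[\mathbb N]^\infty$ with no $\le_S$-upper bound in $[\mathbb N]^\infty$. A set $X\subseteq[\mathbb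 N]^\infty$ with $|X|\ge\mathfrak b(S)$ is an $S$-scale if for each $b\in[\mathbb N]^\infty$ there is $c\in[\mathbb N]^\infty$ such that $b\le_{S^+}c\le_S x$ for all but less than $\mathfrak b(S)$ elements $x\in X$. $a\le^* b$ means $a(n)\le b(n)$ for all but finitely many $n$. $\mathfrak b$ is the minimal cardinality of a $\le^*$-unbounded subset of $[\mathbb N]^\infty$, and $\mathfrak d$ is the minimal cardinality of a dominating set, i.e. a set $D\subseteq[\mathbb N]^\infty$ such that for each $a\in[\mathbb N]^\infty$ there is $d\in D$ with $a\le^* d$. For an infinite cardinal $\kappa$, a topological space $Y$ with $|Y|\ge\kappa$ is $\kappa$-concentrated if there is a countable set $D\subseteq Y$ such that $|Y\setminus U|<\kappa$ for all open sets $U\supseteq D$. A topological space is Menger if for each sequence $\mathcal U_1,\mathcal U_2,\dots$ of its open covers there are finite sets $\mathcal F_1\subseteq\mathcal U_1,\mathcal F_2\subseteq\mathcal U_2,\dots$ whose union is a cover. *)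

theory Defs
  imports "HOL-Analysis.Analysis" "HOL-Library.Infinite_Set"
begin

unbundle cardinal_syntax

text \<open>
  The index set \<open>{1,2,\<dots>}\<close> is represented by the type \<^typ>\<open>nat\<close>, via the order isomorphism
  \<open>n \<mapsto> n - 1\<close>; accordingly \<open>enumerate a n\<close>, the increasing enumeration of \<open>a\<close>, counts from 0.
\<close>

abbreviation inf_sets :: "nat set set" where
  "inf_sets \<equiv> {a. infinite a}"

abbreviation fin_sets :: "nat set set" where
  "fin_sets \<equiv> {a. finite a}"

text \<open>The powerset of \<open>\<nat>\<close> with the topology of \<open>{0,1}\<^sup>\<nat>\<close>, transported along characteristic functions.\<close>

definition cantor_topology :: "nat set topology" where
  "cantor_topology =
     pullback_topology UNIV (\<lambda>a n. n \<in> a)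
       (product_topology (\<lambda>_::nat. discrete_topology (UNIV :: bool set)) UNIV)"

definition nowhere_dense_in :: "'a topology \<Rightarrow> 'a set \<Rightarrow> bool" where
  "nowhere_dense_in T A \<longleftrightarrow> A \<subseteq> topspace T \<and> T interior_of (T closure_of A) = {}"

definition meager_in :: "'a topology \<Rightarrow> 'a set \<Rightarrow> bool" where
  "meager_in T A \<longleftrightarrow> (\<exists>F. countable F \<and> (\<forall>B\<in>F. nowhere_dense_in T B) \<and> A = \<Union>F)"

definition menger_space :: "'a topology \<Rightarrow> bool" where
  "menger_space T \<longleftrightarrow>
     (\<forall>\<U> :: nat \<Rightarrow> 'a set set.
        (\<forall>n. (\<forall>U\<in>\<U> n. openin T U) \<and> \<Union>(\<U> n) = topspace T) \<longrightarrow>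
        (\<exists>\<F>. (\<forall>n. finite (\<F> n) \<and> \<F> n \<subseteq> \<U> n) \<and> (\<Union>n. \<Union>(\<F> n)) = topspace T))"

text \<open>Cardinal numbers are represented by cardinal orders; \<open>\<kappa>\<close> is meant to be an infinite one.\<close>

definition concentrated :: "'k rel \<Rightarrow> 'a topology \<Rightarrow> bool" where
  "concentrated \<kappa> T \<longleftrightarrow>
     \<kappa> \<le>o |topspace T| \<and>
     (\<exists>D. countable D \<and> D \<subseteq> topspace T \<and>
        (\<forall>U. openin T U \<and> D \<subseteq> U \<longrightarrow> |topspace T - U| <o \<kappa>))"

text \<open>The least cardinality of a set with property \<open>P\<close>, provided there is such a set.\<close>

definition min_card :: "('a set \<Rightarrow> bool) \<Rightarrow> 'a rel" where
  "min_card P = |SOME A. P A \<and> (\<forall>B. P B \<longrightarrow> |A| \<le>o |B| )|"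

lemma min_card_attained:
  assumes "P A0"
  shows "\<exists>A. P A \<and> min_card P = |A| \<and> (\<forall>B. P B \<longrightarrow> min_card P \<le>o |B| )"
proof -
  have "\<exists>r \<in> card_of ` Collect P. \<forall>r' \<in> card_of ` Collect P. r \<le>o r'"
    using assms by (intro exists_minim_Well_order) (auto intro: card_of_Well_order)
  then have "\<exists>A. P A \<and> (\<forall>B. P B \<longrightarrow> |A| \<le>o |B| )"
    by auto
  from someI_ex[OF this] show ?thesis
    unfolding min_card_def by blast
qed

definition almost_subset :: "nat set \<Rightarrow> nat set \<Rightarrow> bool" (infix "\<subseteq>\<^sup>*" 50) where
  "a \<subseteq>\<^sup>* b \<longleftrightarrow> finite (a - b)"

definition semifilter :: "nat set set \<Rightarrow> bool" where
  "semifilter S \<longleftrightarrow> S \<noteq> {} \<and> S \<subseteq> inf_sets \<and>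
     (\<forall>s\<in>S. \<forall>b\<in>inf_sets. s \<subseteq>\<^sup>* b \<longrightarrow> b \<in> S)"

definition semifilter_dual :: "nat set set \<Rightarrow> nat set set" where
  "semifilter_dual S = {a \<in> inf_sets. UNIV - a \<notin> S}"

definition le_on :: "nat set set \<Rightarrow> nat set \<Rightarrow> nat set \<Rightarrow> bool" where
  "le_on R a b \<longleftrightarrow> {n. enumerate a n \<le> enumerate b n} \<in> R"

definition le_star :: "nat set \<Rightarrow> nat set \<Rightarrow> bool" (infix "\<le>\<^sup>*" 50) where
  "a \<le>\<^sup>* b \<longleftrightarrow> (\<forall>\<^sub>\<infinity>n. enumerate a n \<le> enumerate b n)"

definition unbounded_fam :: "(nat set \<Rightarrow> nat set \<Rightarrow> bool) \<Rightarrow> nat set set \<Rightarrow> bool" where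
  "unbounded_fam le A \<longleftrightarrow> A \<subseteq> inf_sets \<and> \<not> (\<exists>c\<in>inf_sets. \<forall>a\<in>A. le a c)"

definition dominating_fam :: "nat set set \<Rightarrow> bool" where
  "dominating_fam D \<longleftrightarrow> D \<subseteq> inf_sets \<and> (\<forall>a\<in>inf_sets. \<exists>d\<in>D. a \<le>\<^sup>* d)"

definition bnum_of :: "nat set set \<Rightarrow> nat set rel" where
  "bnum_of S = min_card (unbounded_fam (le_on S))"

definition bnum :: "nat set rel" where
  "bnum = min_card (unbounded_fam (\<le>\<^sup>*))"

definition dnum :: "nat set rel" where
  "dnum = min_card dominating_fam"

text \<open>The three minima are attained, so the choice in \<^const>\<open>min_card\<close> is a genuine one.\<close>

lemma shifted_enumeration:
  assumes "infinite (c :: nat set)"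
  shows "infinite (c - {enumerate c 0})"
    and "enumerate c n < enumerate (c - {enumerate c 0}) n"
  using assms enumerate_step[OF assms, of n] by (auto simp: enumerate_Suc')

lemma unbounded_fam_le_on:
  assumes "semifilter S"
  shows "unbounded_fam (le_on S) inf_sets"
proof -
  have "\<not> le_on S (c - {enumerate c 0}) c" if "infinite c" for c
  proof -
    have "{n. enumerate (c - {enumerate c 0}) n \<le> enumerate c n} = {}"
      using shifted_enumeration(2)[OF that] by (auto simp: not_le)
    then show ?thesis
      using assms unfolding le_on_def semifilter_def by auto
  qed
  then show ?thesis
    unfolding unbounded_fam_def using shifted_enumeration(1) by blast
qed

lemma unbounded_fam_le_star: "unbounded_fam (\<le>\<^sup>*) inf_sets"
proof -
  have "\<not> (c - {enumerate c 0}) \<le>\<^sup>* c" if "infinite c" for c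
    using shifted_enumeration(2)[OF that] by (simp add: le_star_def not_le[symmetric])
  then show ?thesis
    unfolding unbounded_fam_def using shifted_enumeration(1) by blast
qed

lemma dominating_fam_inf_sets: "dominating_fam inf_sets"
  unfolding dominating_fam_def le_star_def by auto

definition semifilter_scale :: "nat set set \<Rightarrow> nat set set \<Rightarrow> bool" where
  "semifilter_scale S X \<longleftrightarrow> X \<subseteq> inf_sets \<and> bnum_of S \<le>o |X| \<and>
     (\<forall>b\<in>inf_sets. \<exists>c\<in>inf_sets.
        le_on (semifilter_dual S) b c \<and> |{x \<in> X. \<not> le_on S c x}| <o bnum_of S)"

end

theory Submission
  imports Defs
begin

text \<open>
  If \<open>S\<close> is meager, Talagrand's argument gives a partition of \<open>\<nat>\<close> into intervals almost all of
  which are hit by every member of \<open>S\<close>, so that \<open>c \<le>\<^sub>S x\<close> bounds \<open>x\<close> from below almost everywhere.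
  For increasing open covers of \<open>(X \<union> [\<nat>]\<^sup><\<^sup>\<infinity>) \<times> Y\<close> each \<open>y \<in> Y\<close> has a function \<open>f y\<close> such that
  \<open>(x, y)\<close> is selected at stage \<open>n\<close> once \<open>x\<close> misses \<open>{f y n..<f y (Suc n)}\<close>. Choosing \<open>c\<close> in the scale
  above the countably many \<open>f y\<close> with \<open>y\<close> in the concentration set, \<open>c\<close> itself is a selection for all
  pairs outside fewer than \<open>\<bb>\<close> rows and columns; those are dealt with by
  concentration in one coordinate.

  If \<open>S\<close> is nonmeager, some \<open>s \<in> S\<close> misses infinitely many intervals of any given partition. This leaves
  room for sets \<open>x\<close> that dominate a given \<open>c\<close> modulo \<open>S\<close> although \<open>- x\<close> has long gaps. Along a
  dominating family this yields an \<open>S\<close>-scale \<open>X\<close> for which \<open>Y = X \<union> {a. finite (- a)}\<close> is concentrated.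
  The diagonal \<open>{(x, x) | x. x \<in> X}\<close> is closed in the product because no finite set is cofinite, and
  \<open>x \<mapsto> starts x\<close> maps it continuously onto a dominating family, so it is not Menger.
\<close>

section \<open>Enumerations and small sets\<close>

lemma enumerate_less_iff:
  fixes A :: "nat set"
  assumes "infinite A"
  shows "enumerate A n < p \<longleftrightarrow> n < card (A \<inter> {..<p})"
proof -
  define I where "I = {i. enumerate A i < p}"
  have fin: "finite I"
  proof (rule finite_subset)
    show "I \<subseteq> {..<p}"
      using le_enumerate[OF assms] by (auto simp: I_def intro: le_less_trans)
  qed simp
  have "A \<inter> {..<p} = enumerate A ` I"
    using enumerate_Ex[OF assms] enumerate_in_set[OF assms] unfolding I_def
    by (auto simp: image_iff)
  then have card: "card (A \<inter> {..<p}) = card I"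
    using inj_enumerate[OF assms] by (simp add: card_image inj_on_subset)
  have down: "{..i} \<subseteq> I" if "i \<in> I" for i
    using that assms by (auto simp: I_def intro: le_less_trans[of _ "enumerate A i"])
  show ?thesis
  proof
    assume "enumerate A n < p"
    then have "card {..n} \<le> card I"
      using down fin by (intro card_mono) (auto simp: I_def)
    then show "n < card (A \<inter> {..<p})"
      by (simp add: card)
  next
    assume *: "n < card (A \<inter> {..<p})"
    show "enumerate A n < p"
    proof (rule ccontr)
      assume "\<not> enumerate A n < p"
      then have "n \<notin> I"
        by (simp add: I_def)
      then have "I \<subseteq> {..<n}"
        using down by (meson atMost_iff lessThan_iff not_le subset_iff)
      then show False
        using * card card_mono[of "{..<n}" I] by simp
    qed
  qed
qed

lemma enumerate_range:
  fixes f :: "nat \<Rightarrow> nat"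
  assumes "strict_mono f"
  shows "infinite (range f)" and "enumerate (range f) = f"
proof -
  show inf: "infinite (range f)"
    using assms by (simp add: finite_image_iff strict_mono_imp_inj_on)
  have *: "range f \<inter> {..<f n} = f ` {..<n}" for n
    using assms by (auto simp: strict_mono_less)
  have card: "card (range f \<inter> {..<f n}) = n" for n
    unfolding * using assms by (simp add: card_image strict_mono_imp_inj_on)
  \<comment> \<open>The enumeration is squeezed: it is at least \<open>f n\<close>, and below
    \<open>f (Suc n)\<close> while being a value of \<open>f\<close>.\<close>
  have "\<not> enumerate (range f) n < f n" for n
    by (simp add: enumerate_less_iff[OF inf] card)
  moreover have "enumerate (range f) n < Suc (f n)" for n
  proof -
    have "enumerate (range f) n < f (Suc n)"
      by (simp add: enumerate_less_iff[OF inf] card)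
    moreover obtain k where k: "enumerate (range f) n = f k"
      using enumerate_in_set[OF inf] by blast
    ultimately show ?thesis
      using assms by (simp add: strict_mono_less strict_mono_less_eq less_Suc_eq_le)
  qed
  ultimately show "enumerate (range f) = f"
    by (intro ext) (metis not_less_less_Suc_eq)
qed

lemma infinite_set_above:
  fixes g :: "nat \<Rightarrow> nat"
  obtains b where "infinite b" "\<And>n. g n \<le> enumerate b n"
proof -
  define G where "G n = (\<Sum>i\<le>n. Suc (g i))" for n
  have "strict_mono G"
    by (auto simp: strict_mono_Suc_iff G_def)
  moreover have "g n \<le> G n" for n
    using member_le_sum[of n "{..n}" "\<lambda>i. Suc (g i)"] by (simp add: G_def)
  ultimately show ?thesis
    using that[of "range G"] by (simp add: enumerate_range)
qed

lemma infinite_set_above_mono: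
  fixes g :: "nat \<Rightarrow> nat"
  obtains b where "infinite b" "\<And>n i. i \<le> n \<Longrightarrow> g i \<le> enumerate b n"
  by (metis enumerate_mono_le_iff infinite_set_above order_trans)

lemma le_star_trans: "a \<le>\<^sup>* b \<Longrightarrow> b \<le>\<^sup>* c \<Longrightarrow> a \<le>\<^sup>* c"
  unfolding le_star_def by (erule (1) MOST_rev_mp[OF _ MOST_mono]) auto

text \<open>A set of size less than the bounding number is small; small sets replace such sets below,
  which avoids all cardinal arithmetic.\<close>

definition small :: "'a set \<Rightarrow> bool" where
  "small A \<longleftrightarrow> (\<forall>f :: 'a \<Rightarrow> nat \<Rightarrow> nat. \<exists>g. \<forall>a\<in>A. \<forall>\<^sub>\<infinity>n. f a n \<le> g n)"

lemma small_subset: "small A \<Longrightarrow> B \<subseteq> A \<Longrightarrow> small B"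
  unfolding small_def by (meson subsetD)

text \<open>Diagonalization: at \<open>n\<close> take the maximum of the first \<open>n + 1\<close>
  bounds, so that each of them is respected from its own index on.\<close>

lemma small_UN_nat:
  fixes A :: "nat \<Rightarrow> 'a set"
  assumes "\<And>i. small (A i)"
  shows "small (\<Union>i. A i)"
  unfolding small_def
proof
  fix f :: "'a \<Rightarrow> nat \<Rightarrow> nat"
  have "\<exists>g. \<forall>a\<in>A i. \<forall>\<^sub>\<infinity>n. f a n \<le> g n" for i
    using assms[of i] by (simp add: small_def)
  then obtain g where g: "\<And>i a. a \<in> A i \<Longrightarrow> \<forall>\<^sub>\<infinity>n. f a n \<le> g i n"
    by metis
  have "\<forall>\<^sub>\<infinity>n. f a n \<le> Max ((\<lambda>j. g j n) ` {..n})" if "a \<in> A i" for i a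
  proof -
    have "\<forall>\<^sub>\<infinity>n. f a n \<le> g i n \<and> i \<le> n"
      using g[OF that] MOST_ge_nat[of i] by (simp add: eventually_conj_iff)
    then show ?thesis
    proof (rule MOST_mono)
      fix n assume *: "f a n \<le> g i n \<and> i \<le> n"
      then have "g i n \<le> Max ((\<lambda>j. g j n) ` {..n})"
        by (intro Max_ge) auto
      with * show "f a n \<le> Max ((\<lambda>j. g j n) ` {..n})" by linarith
    qed
  qed
  then show "\<exists>h. \<forall>a\<in>\<Union>i. A i. \<forall>\<^sub>\<infinity>n. f a n \<le> h n"
    by (intro exI[of _ "\<lambda>n. Max ((\<lambda>j. g j n) ` {..n})"]) auto
qed

lemma small_countable:
  assumes "countable A"
  shows "small A"
proof (cases "A = {}")
  case False
  have "small {a}" for a :: 'a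
    unfolding small_def by (metis MOST_I order_refl singletonD)
  then have "small (\<Union>i. {from_nat_into A i})"
    by (rule small_UN_nat)
  then show ?thesis
    using range_from_nat_into[OF False assms] by (simp add: UNION_singleton_eq_range)
qed (simp add: small_def)

lemma small_Un:
  assumes "small A" "small B"
  shows "small (A \<union> B)"
proof -
  have "small (\<Union>i::nat. if i = 0 then A else B)"
    using assms by (intro small_UN_nat) auto
  moreover have "A \<union> B \<subseteq> (\<Union>i::nat. if i = 0 then A else B)"
    by (auto split: if_splits)
  ultimately show ?thesis
    by (rule small_subset)
qed

section \<open>Minimal cardinalities of unbounded and dominating families\<close>

lemma bnum_le: "unbounded_fam (\<le>\<^sup>*) B \<Longrightarrow> bnum \<le>o |B|"
  unfolding bnum_def using min_card_attained[of _ inf_sets] unbounded_fam_le_star by blast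

lemma dnum_le: "dominating_fam B \<Longrightarrow> dnum \<le>o |B|"
  unfolding dnum_def using min_card_attained[of _ inf_sets] dominating_fam_inf_sets by blast

lemma bnum_of_le: "semifilter S \<Longrightarrow> unbounded_fam (le_on S) B \<Longrightarrow> bnum_of S \<le>o |B|"
  unfolding bnum_of_def using min_card_attained[of _ inf_sets] unbounded_fam_le_on by blast

lemma bounded_if_less_bnum:
  assumes "|A| <o bnum" "A \<subseteq> inf_sets"
  obtains c where "infinite c" "\<And>a. a \<in> A \<Longrightarrow> a \<le>\<^sup>* c"
  using assms bnum_le[of A] not_ordLess_ordLeq unfolding unbounded_fam_def by blast

lemma bounded_if_less_bnum_of:
  assumes "semifilter S" "|A| <o bnum_of S" "A \<subseteq> inf_sets"
  obtains c where "infinite c" "\<And>a. a \<in> A \<Longrightarrow> le_on S a c"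
  using assms bnum_of_le[of S A] not_ordLess_ordLeq unfolding unbounded_fam_def by blast

lemma image_less_card: "|A| <o r \<Longrightarrow> |f ` A| <o r"
  using card_of_image ordLeq_ordLess_trans by blast

lemma small_if_less_bnum:
  assumes "|A| <o bnum"
  shows "small A"
  unfolding small_def
proof
  fix f :: "'a \<Rightarrow> nat \<Rightarrow> nat"
  have "\<exists>b. infinite b \<and> (\<forall>n. f a n \<le> enumerate b n)" for a
    using infinite_set_above by metis
  then obtain b where b: "\<And>a. infinite (b a)" "\<And>a n. f a n \<le> enumerate (b a) n"
    by metis
  have "b ` A \<subseteq> inf_sets"
    using b(1) by auto
  from bounded_if_less_bnum[OF image_less_card[OF assms] this]
  obtain c where c: "infinite c" "\<And>a. a \<in> A \<Longrightarrow> b a \<le>\<^sup>* c"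
    by (metis image_eqI)
  have "\<forall>\<^sub>\<infinity>n. f a n \<le> enumerate c n" if "a \<in> A" for a
    using c(2)[OF that] unfolding le_star_def by (rule MOST_mono) (metis b(2) order_trans)
  then show "\<exists>g. \<forall>a\<in>A. \<forall>\<^sub>\<infinity>n. f a n \<le> g n"
    by blast
qed

text \<open>For strictly increasing \<open>h\<close> the intervals partition \<open>{h 0..}\<close>.
  This is the condition in Talagrand's characterization of meagerness.\<close>

definition hits :: "(nat \<Rightarrow> nat) \<Rightarrow> nat set \<Rightarrow> bool" where
  "hits h s \<longleftrightarrow> (\<forall>\<^sub>\<infinity>k. s \<inter> {h k..<h (Suc k)} \<noteq> {})"

text \<open>A bound modulo \<open>S\<close> holds somewhere in almost every interval, and
  monotonicity carries it to the right endpoint. The sets \<open>b a\<close> lie above all earlier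
  values of \<open>f a\<close>, so the position inside the interval does not matter.\<close>

lemma small_if_less_bnum_of:
  assumes S: "semifilter S" and h: "strict_mono h" "\<And>s. s \<in> S \<Longrightarrow> hits h s"
    and A: "|A| <o bnum_of S"
  shows "small A"
  unfolding small_def
proof
  fix f :: "'a \<Rightarrow> nat \<Rightarrow> nat"
  have "\<exists>b. infinite b \<and> (\<forall>n i. i \<le> n \<longrightarrow> f a i \<le> enumerate b n)" for a
    using infinite_set_above_mono[of "f a"] by metis
  then obtain b where b: "\<And>a. infinite (b a)" "\<And>a n i. i \<le> n \<Longrightarrow> f a i \<le> enumerate (b a) n"
    by metis
  have "b ` A \<subseteq> inf_sets"
    using b(1) by auto
  from bounded_if_less_bnum_of[OF S image_less_card[OF A] this]
  obtain c where c: "infinite c" "\<And>a. a \<in> A \<Longrightarrow> le_on S (b a) c"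
    by (metis image_eqI)
  have "\<forall>\<^sub>\<infinity>n. f a n \<le> enumerate c (h (Suc n))" if "a \<in> A" for a
  proof -
    have "hits h {n. enumerate (b a) n \<le> enumerate c n}"
      using c(2)[OF that] h(2) unfolding le_on_def by blast
    then show ?thesis
      unfolding hits_def
    proof (rule MOST_mono)
      fix k assume "{n. enumerate (b a) n \<le> enumerate c n} \<inter> {h k..<h (Suc k)} \<noteq> {}"
      then obtain m where m: "h k \<le> m" "m < h (Suc k)" "enumerate (b a) m \<le> enumerate c m"
        by auto
      have "k \<le> m"
        using m(1) h(1) strict_mono_imp_increasing order_trans by blast
      then have "f a k \<le> enumerate (b a) m"
        by (rule b(2))
      also have "\<dots> \<le> enumerate c m" by (rule m(3))
      also have "\<dots> \<le> enumerate c (h (Suc k))"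
        using c(1) m(2) by simp
      finally show "f a k \<le> enumerate c (h (Suc k))" .
    qed
  qed
  then show "\<exists>g. \<forall>a\<in>A. \<forall>\<^sub>\<infinity>n. f a n \<le> g n"
    by (intro exI[of _ "\<lambda>n. enumerate c (h (Suc n))"]) auto
qed

section \<open>The Cantor space\<close>

definition cyl :: "nat set \<Rightarrow> nat \<Rightarrow> nat set set" where
  "cyl a m = {x. \<forall>i<m. i \<in> x \<longleftrightarrow> i \<in> a}"

lemma self_in_cyl [simp]: "a \<in> cyl a m"
  by (simp add: cyl_def)

lemma cyl_antimono: "m \<le> n \<Longrightarrow> cyl a n \<subseteq> cyl a m"
  by (auto simp: cyl_def)

lemma openin_cantor: "openin cantor_topology U \<longleftrightarrow> (\<forall>a\<in>U. \<exists>m. cyl a m \<subseteq> U)"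
proof -
  let ?\<chi> = "\<lambda>(a::nat set) n. n \<in> a"
  let ?T = "product_topology (\<lambda>_::nat. discrete_topology (UNIV :: bool set)) UNIV"
  have eq: "openin cantor_topology U \<longleftrightarrow> openin ?T {p. {n. p n} \<in> U}"
  proof -
    have 1: "V = {p. {n. p n} \<in> U}" if "U = ?\<chi> -` V \<inter> UNIV" for V
      unfolding that by simp
    have 2: "U = ?\<chi> -` {p. {n. p n} \<in> U} \<inter> UNIV"
      by simp
    show ?thesis
      unfolding cantor_topology_def openin_pullback_topology using 1 2 by metis
  qed
  show ?thesis
  proof
    assume "openin cantor_topology U"
    then have op: "openin ?T {p. {n. p n} \<in> U}" by (simp add: eq)
    show "\<forall>a\<in>U. \<exists>m. cyl a m \<subseteq> U"
    proof
      fix a assume "a \<in> U"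
      then have "?\<chi> a \<in> {p. {n. p n} \<in> U}" by simp
      then obtain V where V: "finite {i \<in> UNIV. V i \<noteq> topspace (discrete_topology (UNIV::bool set))}"
          "?\<chi> a \<in> Pi\<^sub>E UNIV V" "Pi\<^sub>E UNIV V \<subseteq> {p. {n. p n} \<in> U}"
        using op unfolding openin_product_topology_alt by meson
      obtain m where m: "\<forall>i. V i \<noteq> UNIV \<longrightarrow> i < m"
        using V(1) finite_nat_bounded[of "{i. V i \<noteq> UNIV}"] by auto
      have "cyl a m \<subseteq> U"
      proof
        fix x assume "x \<in> cyl a m"
        have "(i \<in> x) \<in> V i" for i
        proof (cases "i < m")
          case True
          then have "(i \<in> x) = (i \<in> a)" using \<open>x \<in> cyl a m\<close> by (simp add: cyl_def)
          then show ?thesis using PiE_mem[OF V(2), of i] by simp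
        next
          case False
          then show ?thesis using m by blast
        qed
        then have "?\<chi> x \<in> Pi\<^sub>E UNIV V"
          by (simp add: PiE_iff)
        then show "x \<in> U" using V(3) by auto
      qed
      then show "\<exists>m. cyl a m \<subseteq> U" by blast
    qed
  next
    assume R: "\<forall>a\<in>U. \<exists>m. cyl a m \<subseteq> U"
    have "openin ?T {p. {n. p n} \<in> U}"
      unfolding openin_product_topology_alt
    proof (intro conjI ballI)
      fix p assume "p \<in> {p. {n. p n} \<in> U}"
      then obtain m where m: "cyl {n. p n} m \<subseteq> U" using R by auto
      let ?V = "\<lambda>i. if i < m then {p i} else UNIV"
      have "finite {i \<in> UNIV. ?V i \<noteq> topspace (discrete_topology (UNIV::bool set))}"
        by (rule finite_subset[of _ "{..<m}"]) auto
      moreover have "Pi\<^sub>E UNIV ?V \<subseteq> {p. {n. p n} \<in> U}"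
      proof
        fix q assume "q \<in> Pi\<^sub>E UNIV ?V"
        then have "q i \<in> ?V i" for i
          by (rule PiE_mem) simp
        then have "q i = p i" if "i < m" for i
          using that by (metis singletonD)
        then have "{n. q n} \<in> cyl {n. p n} m"
          unfolding cyl_def by simp
        then show "q \<in> {p. {n. p n} \<in> U}" using m by auto
      qed
      ultimately show "\<exists>V. finite {i \<in> UNIV. V i \<noteq> topspace (discrete_topology (UNIV::bool set))} \<and>
          (\<forall>i\<in>UNIV. openin (discrete_topology UNIV) (V i)) \<and> p \<in> Pi\<^sub>E UNIV V \<and>
          Pi\<^sub>E UNIV V \<subseteq> {p. {n. p n} \<in> U}"
        by (intro exI[of _ ?V]) auto
    qed
    then show "openin cantor_topology U" by (simp add: eq)
  qed
qed

lemma topspace_cantor [simp]: "topspace cantor_topology = UNIV"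
  using openin_cantor[of UNIV] openin_subset by blast

lemma openin_cyl: "openin cantor_topology (cyl a m)"
  unfolding openin_cantor by (auto simp: cyl_def)

lemma second_countable_cantor: "second_countable cantor_topology"
  unfolding second_countable_def
proof (intro exI conjI ballI allI impI)
  let ?B = "(\<lambda>(s, m). cyl s m) ` (Collect finite \<times> UNIV)"
  show "countable ?B"
    by (intro countable_image countable_SIGMA countable_Collect_finite) auto
  show "openin cantor_topology V" if "V \<in> ?B" for V
    using that openin_cyl by auto
  fix U x assume "openin cantor_topology U \<and> x \<in> U"
  then obtain m where "cyl x m \<subseteq> U" unfolding openin_cantor by blast
  moreover have "cyl x m = cyl (x \<inter> {..<m}) m" by (simp add: cyl_def)
  ultimately show "\<exists>V\<in>?B. x \<in> V \<and> V \<subseteq> U"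
    by (intro bexI[of _ "cyl (x \<inter> {..<m}) m"] image_eqI[of _ _ "(x \<inter> {..<m}, m)"])
      (auto simp: cyl_def)
qed

lemma second_countable_prod_topology:
  assumes "second_countable X" "second_countable Y"
  shows "second_countable (prod_topology X Y)"
proof -
  obtain A where A: "countable A" "\<And>V. V \<in> A \<Longrightarrow> openin X V"
      "\<And>U x. openin X U \<and> x \<in> U \<longrightarrow> (\<exists>V\<in>A. x \<in> V \<and> V \<subseteq> U)"
    using assms(1) unfolding second_countable_def by auto
  obtain B where B: "countable B" "\<And>V. V \<in> B \<Longrightarrow> openin Y V"
      "\<And>U x. openin Y U \<and> x \<in> U \<longrightarrow> (\<exists>V\<in>B. x \<in> V \<and> V \<subseteq> U)"
    using assms(2) unfolding second_countable_def by auto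
  show ?thesis
    unfolding second_countable_def
  proof (intro exI conjI ballI allI impI)
    show "countable ((\<lambda>(U, V). U \<times> V) ` (A \<times> B))"
      using A(1) B(1) by simp
    show "openin (prod_topology X Y) V" if "V \<in> (\<lambda>(U, V). U \<times> V) ` (A \<times> B)" for V
      using that A(2) B(2) by (auto simp: openin_prod_Times_iff)
    fix U z assume U: "openin (prod_topology X Y) U \<and> z \<in> U"
    then obtain V W where VW: "openin X V" "openin Y W" "fst z \<in> V" "snd z \<in> W" "V \<times> W \<subseteq> U"
      unfolding openin_prod_topology_alt by (metis prod.collapse)
    obtain V' W' where "V' \<in> A" "fst z \<in> V'" "V' \<subseteq> V" "W' \<in> B" "snd z \<in> W'" "W' \<subseteq> W"
      using A(3) B(3) VW(1-4) by metis
    then show "\<exists>V\<in>(\<lambda>(U, V). U \<times> V) ` (A \<times> B). z \<in> V \<and> V \<subseteq> U"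
      using VW(5) by (intro bexI[of _ "V' \<times> W'"]) (auto simp: mem_Times_iff)
  qed
qed

lemma second_countable_euclidean:
  "second_countable (euclidean :: 'a::second_countable_topology topology)"
proof -
  obtain B :: "'a set set" where "countable B" "topological_basis B"
    using ex_countable_basis by blast
  then show ?thesis
    unfolding second_countable_def
    by (intro exI[of _ B]) (metis open_openin topological_basisE topological_basis_open)
qed

text \<open>Every cylinder contains a smaller one missing \<open>B\<close>; shrinking it further
  allows any lower bound \<open>m\<close> on its length, which suits constructions by finite
  extension.\<close>

lemma nowhere_dense_cantor:
  "nowhere_dense_in cantor_topology B \<longleftrightarrow>
     (\<forall>a m. \<exists>b n. m \<le> n \<and> b \<in> cyl a m \<and> cyl b n \<inter> B = {})"
proof -
  have cl: "x \<in> cantor_topology closure_of B \<longleftrightarrow> (\<forall>n. cyl x n \<inter> B \<noteq> {})" for x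
  proof -
    have "x \<in> cantor_topology closure_of B \<longleftrightarrow>
        (\<forall>T. x \<in> T \<and> openin cantor_topology T \<longrightarrow> B \<inter> T \<noteq> {})"
      unfolding in_closure_of by auto
    also have "\<dots> \<longleftrightarrow> (\<forall>n. B \<inter> cyl x n \<noteq> {})"
    proof safe
      fix T assume *: "\<forall>n. B \<inter> cyl x n \<noteq> {}" "x \<in> T" "openin cantor_topology T" "B \<inter> T = {}"
      then obtain n where "cyl x n \<subseteq> T" unfolding openin_cantor by blast
      with * show False by blast
    next
      fix n assume *: "\<forall>T. x \<in> T \<and> openin cantor_topology T \<longrightarrow> B \<inter> T \<noteq> {}" "B \<inter> cyl x n = {}"
      then show False using openin_cyl[of x n] self_in_cyl[of x n] by metis
    qed
    finally show ?thesis by (simp add: Int_commute)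
  qed
  have "nowhere_dense_in cantor_topology B \<longleftrightarrow>
      (\<forall>a m. \<not> cyl a m \<subseteq> cantor_topology closure_of B)"
    (is "?L \<longleftrightarrow> ?R")
  proof
    assume ?L
    then have "cantor_topology interior_of (cantor_topology closure_of B) = {}"
      by (simp add: nowhere_dense_in_def)
    then show ?R
      using interior_of_maximal[OF _ openin_cyl, of _ _ "cantor_topology closure_of B"] self_in_cyl
      by (metis empty_iff subsetD)
  next
    assume ?R
    have "cantor_topology interior_of (cantor_topology closure_of B) = {}"
    proof (rule ccontr)
      assume "\<not> ?thesis"
      then obtain a where a: "a \<in> cantor_topology interior_of (cantor_topology closure_of B)"
        by blast
      then obtain m where "cyl a m \<subseteq> cantor_topology interior_of (cantor_topology closure_of B)"
        using openin_interior_of openin_cantor by meson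
      then have "cyl a m \<subseteq> cantor_topology closure_of B"
        using interior_of_subset[of cantor_topology "cantor_topology closure_of B"] by (rule order_trans)
      with \<open>?R\<close> show False
        by metis
    qed
    then show ?L by (simp add: nowhere_dense_in_def)
  qed
  also have "\<dots> \<longleftrightarrow> (\<forall>a m. \<exists>b n. m \<le> n \<and> b \<in> cyl a m \<and> cyl b n \<inter> B = {})"
  proof -
    have "\<not> cyl a m \<subseteq> cantor_topology closure_of B \<longleftrightarrow>
        (\<exists>b n. b \<in> cyl a m \<and> cyl b n \<inter> B = {})" for a m
      unfolding subset_iff cl by auto
    moreover have "cyl b n \<inter> B = {} \<Longrightarrow> cyl b (max m n) \<inter> B = {}" for b n m
      using cyl_antimono[of n "max m n" b] by auto
    ultimately show ?thesis
      by (metis max.cobounded1)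
  qed
  finally show ?thesis .
qed

section \<open>Meager semifilters\<close>

text \<open>The pairs of a prefix and a nowhere dense set are treated one after another. Each time
  the common pattern \<open>t\<close> is prolonged; the earlier pairs stay avoided because their
  cylinders only shrink.\<close>

lemma avoid_extension:
  assumes "finite P" and "\<forall>B\<in>snd ` P. nowhere_dense_in cantor_topology B"
  shows "\<exists>t n. m \<le> n \<and> t \<subseteq> {m..<n} \<and> (\<forall>p\<in>P. cyl (fst p \<inter> {..<m} \<union> t) n \<inter> snd p = {})"
  using assms
proof (induction P rule: finite_induct)
  case empty
  show ?case by auto
next
  case (insert p P)
  let ?s = "fst p \<inter> {..<m}"
  have "\<forall>B\<in>snd ` P. nowhere_dense_in cantor_topology B"
    using insert.prems by simp
  then obtain t n where t: "m \<le> n" "t \<subseteq> {m..<n}"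
      and P: "\<forall>q\<in>P. cyl (fst q \<inter> {..<m} \<union> t) n \<inter> snd q = {}"
    using insert.IH by metis
  have "nowhere_dense_in cantor_topology (snd p)"
    using insert.prems by simp
  then obtain b n' where b: "n \<le> n'" "b \<in> cyl (?s \<union> t) n" "cyl b n' \<inter> snd p = {}"
    unfolding nowhere_dense_cantor by metis
  let ?t = "b \<inter> {m..<n'}"
  have bt: "i \<in> b \<longleftrightarrow> i \<in> ?s \<union> t" if "i < n" for i
    using b(2) that by (simp add: cyl_def)
  have "i \<in> ?s \<union> ?t \<longleftrightarrow> i \<in> b" if "i < n'" for i
  proof (cases "i < m")
    case True
    then have "i \<notin> t" "i < n" using t by auto
    then show ?thesis using bt True by simp
  qed (use that in simp)
  then have "cyl (?s \<union> ?t) n' = cyl b n'"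
    by (simp add: cyl_def)
  then have "cyl (?s \<union> ?t) n' \<inter> snd p = {}"
    using b(3) by simp
  moreover have "cyl (fst q \<inter> {..<m} \<union> ?t) n' \<inter> snd q = {}" if "q \<in> P" for q
  proof -
    have "i \<in> ?t \<longleftrightarrow> i \<in> t" if "i < n" for i
      using b(1) t bt[OF that] that by (cases "i < m") auto
    then have "cyl (fst q \<inter> {..<m} \<union> ?t) n' \<subseteq> cyl (fst q \<inter> {..<m} \<union> t) n"
      using b(1) by (auto simp: cyl_def)
    then show ?thesis
      using P that by blast
  qed
  ultimately show ?case
    using b(1) t(1) by (intro exI[of _ ?t] exI[of _ n']) auto
qed

text \<open>One half of Talagrand's characterization of meager semifilters.\<close>

lemma meager_semifilter_imp_hits:
  assumes S: "semifilter S" and M: "meager_in cantor_topology S"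
  obtains h where "strict_mono h" "\<And>s. s \<in> S \<Longrightarrow> hits h s"
proof -
  obtain F where F: "countable F" "\<And>B. B \<in> F \<Longrightarrow> nowhere_dense_in cantor_topology B" "S = \<Union>F"
    using M unfolding meager_in_def by blast
  have "F \<noteq> {}"
    using S F(3) unfolding semifilter_def by blast
  define B where "B = from_nat_into F"
  have rB: "range B = F"
    using F(1) \<open>F \<noteq> {}\<close> by (simp add: B_def range_from_nat_into)
  have nd: "nowhere_dense_in cantor_topology (B i)" for i
    using F(2) rB by blast
  \<comment> \<open>There are finitely many prefixes below \<open>m\<close> and finitely many sets
    \<open>B i\<close> with \<open>i \<le> k\<close>, so one pattern avoids all of these sets after
    any prefix. Passing to \<open>Suc n\<close> makes the block nonempty.\<close>
  have "\<exists>t n. m < n \<and> t \<subseteq> {m..<n} \<and> (\<forall>s i. i \<le> k \<longrightarrow> cyl (s \<inter> {..<m} \<union> t) n \<inter> B i = {})" for m k :: nat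
  proof -
    let ?P = "Pow {..<m} \<times> B ` {..k}"
    have "finite ?P" "\<forall>C\<in>snd ` ?P. nowhere_dense_in cantor_topology C"
      using nd by auto
    from avoid_extension[OF this, of m] obtain t n where
        t: "m \<le> n" "t \<subseteq> {m..<n}" "\<forall>p\<in>?P. cyl (fst p \<inter> {..<m} \<union> t) n \<inter> snd p = {}"
      by metis
    have "cyl (s \<inter> {..<m} \<union> t) (Suc n) \<inter> B i = {}" if "i \<le> k" for s i
    proof -
      have "(s \<inter> {..<m}, B i) \<in> ?P"
        using that by auto
      then have "cyl (s \<inter> {..<m} \<inter> {..<m} \<union> t) n \<inter> B i = {}"
        using bspec[OF t(3), of "(s \<inter> {..<m}, B i)"] by simp
      then show ?thesis
        using cyl_antimono[of n "Suc n" "s \<inter> {..<m} \<union> t"] by (auto simp: Int_assoc)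
    qed
    then show ?thesis
      using t(1,2) by (intro exI[of _ t] exI[of _ "Suc n"]) auto
  qed
  then obtain T N where T: "\<And>m k. m < N m k" "\<And>m k. T m k \<subseteq> {m..<N m k}"
      "\<And>m k s i. i \<le> k \<Longrightarrow> cyl (s \<inter> {..<m} \<union> T m k) (N m k) \<inter> B i = {}"
    by metis
  define h where "h = rec_nat 0 (\<lambda>k x. N x k)"
  have h: "h (Suc k) = N (h k) k" for k
    by (simp add: h_def)
  have mono: "strict_mono h"
    by (simp add: strict_mono_Suc_iff h T(1))
  have "hits h s" if s: "s \<in> S" for s
  proof (rule ccontr)
    assume "\<not> hits h s"
    then have inf: "\<exists>\<^sub>\<infinity>k. s \<inter> {h k..<h (Suc k)} = {}"
      by (simp add: hits_def not_MOST)
    \<comment> \<open>Filling the blocks missed by \<open>s\<close> with the avoiding patterns keeps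
      the set in the semifilter, which is closed upwards, yet brings it outside every
      \<open>B i\<close>.\<close>
    define J where "J = {k. s \<inter> {h k..<h (Suc k)} = {}}"
    define s' where "s' = s \<union> (\<Union>k\<in>J. T (h k) k)"
    have "infinite s'"
      using S s unfolding s'_def semifilter_def by auto
    moreover have "s \<subseteq>\<^sup>* s'"
      by (simp add: s'_def almost_subset_def Diff_eq_empty_iff[THEN iffD2])
    ultimately have "s' \<in> S"
      using S s unfolding semifilter_def by blast
    then obtain i where i: "s' \<in> B i"
      using F(3) rB by blast
    obtain k where k: "k \<in> J" "i \<le> k"
      using inf unfolding J_def INFM_nat_le by auto
    \<comment> \<open>Patterns of different blocks do not overlap, so on a missed block
      \<open>k\<close> the set \<open>s'\<close> is exactly the pattern
      \<open>T (h k) k\<close>.\<close>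
    have "j \<in> T (h k) k" if j: "j \<in> s'" "h k \<le> j" "j < h (Suc k)" for j
    proof -
      have "j \<notin> s"
        using j k(1) by (auto simp: J_def)
      then obtain l where l: "j \<in> T (h l) l"
        using j(1) by (auto simp: s'_def)
      then have "h l \<le> j" "j < h (Suc l)"
        using T(2)[of "h l" l] by (auto simp: h)
      then have "h l < h (Suc k)" "h k < h (Suc l)"
        using j by auto
      then have "l = k"
        using mono by (simp add: strict_mono_less)
      then show ?thesis
        using l by simp
    qed
    moreover have "T (h k) k \<subseteq> s'"
      using k(1) by (auto simp: s'_def)
    moreover have "T (h k) k \<subseteq> {h k..<h (Suc k)}"
      using T(2)[of "h k" k] by (simp add: h)
    ultimately have "s' \<in> cyl (s' \<inter> {..<h k} \<union> T (h k) k) (h (Suc k))"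
      unfolding cyl_def by (simp add: subset_iff) (meson not_le)
    then show False
      using T(3)[OF k(2), of s' "h k"] i by (auto simp: h)
  qed
  then show ?thesis
    using that mono by blast
qed

text \<open>The sets meeting every interval from the \<open>m\<close>-th on form a nowhere dense
  set: a finite prefix can be continued by zeros through a whole later interval. Countably many such
  sets cannot exhaust \<open>S\<close>.\<close>

lemma nonmeager_imp_not_hits:
  assumes "\<not> meager_in cantor_topology S" and h: "strict_mono h"
  obtains s where "s \<in> S" "\<not> hits h s"
proof -
  define B where "B m = {s. \<forall>k\<ge>m. s \<inter> {h k..<h (Suc k)} \<noteq> {}}" for m
  have "nowhere_dense_in cantor_topology (B m \<inter> S)" for m
    unfolding nowhere_dense_cantor
  proof (intro allI)
    fix a :: "nat set" and p :: nat
    define k where "k = max m p"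
    have p: "p \<le> h k"
      using strict_mono_imp_increasing[OF h, of k] by (simp add: k_def)
    have hk: "h k < h (Suc k)"
      using h by (simp add: strict_mono_less)
    have "x \<notin> B m" if x: "x \<in> cyl (a \<inter> {..<p}) (h (Suc k))" for x
    proof -
      have "x \<inter> {h k..<h (Suc k)} = {}"
        using x p by (auto simp: cyl_def)
      then show ?thesis
        unfolding B_def using max.cobounded1[of m p] k_def by blast
    qed
    then show "\<exists>b n. p \<le> n \<and> b \<in> cyl a p \<and> cyl b n \<inter> (B m \<inter> S) = {}"
      using p hk by (intro exI[of _ "a \<inter> {..<p}"] exI[of _ "h (Suc k)"]) (auto simp: cyl_def)
  qed
  then have "S \<noteq> (\<Union>m. B m \<inter> S)"
    using assms(1) unfolding meager_in_def
    by (metis (mono_tags, lifting) countableI_type countable_image imageE)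
  then obtain s where "s \<in> S" "\<And>m. s \<notin> B m"
    by auto
  then show ?thesis
    using that unfolding B_def hits_def by (auto simp: MOST_nat_le)
qed

section \<open>Selections from increasing covers\<close>

text \<open>The Menger property for increasing covers, where a finite subfamily amounts to one
  member \<open>W n (g n)\<close>. Asking for infinitely many \<open>n\<close> instead of one makes
  the notion stable under small unions.\<close>

definition selectable :: "(nat \<Rightarrow> nat \<Rightarrow> 'a set) \<Rightarrow> 'a set \<Rightarrow> bool" where
  "selectable W Z \<longleftrightarrow> (\<exists>g. \<forall>z\<in>Z. \<exists>\<^sub>\<infinity>n. z \<in> W n (g n))"

lemma selectable_subset: "selectable W Z \<Longrightarrow> Z' \<subseteq> Z \<Longrightarrow> selectable W Z'"
  unfolding selectable_def by blast

text \<open>If \<open>g\<close> eventually dominates each selection \<open>f a\<close>, then an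
  infinite set of successes of \<open>f a\<close> leaves infinitely many successes of
  \<open>g\<close>, as the covers increase.\<close>

lemma selectable_UN:
  fixes W :: "nat \<Rightarrow> nat \<Rightarrow> 'a set"
  assumes W: "\<And>n. mono (W n)" and A: "small A" and Z: "\<And>a. a \<in> A \<Longrightarrow> selectable W (Z a)"
  shows "selectable W (\<Union>a\<in>A. Z a)"
proof -
  obtain f where f: "\<And>a z. a \<in> A \<Longrightarrow> z \<in> Z a \<Longrightarrow> \<exists>\<^sub>\<infinity>n. z \<in> W n (f a n)"
    using Z unfolding selectable_def by metis
  obtain g where g: "\<And>a. a \<in> A \<Longrightarrow> \<forall>\<^sub>\<infinity>n. f a n \<le> g n"
    using A unfolding small_def by meson
  have "\<exists>\<^sub>\<infinity>n. z \<in> W n (g n)" if "a \<in> A" "z \<in> Z a" for a z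
  proof -
    have "\<exists>\<^sub>\<infinity>n. z \<in> W n (f a n) \<and> f a n \<le> g n"
      using f[OF that] g[OF that(1)] by (rule INFM_conjI)
    then show ?thesis
      by (rule INFM_mono) (use W in \<open>auto dest: monoD\<close>)
  qed
  then show ?thesis
    unfolding selectable_def by blast
qed

lemma selectable_Un:
  assumes "\<And>n. mono (W n)" "selectable W A" "selectable W B"
  shows "selectable W (A \<union> B)"
proof -
  have "selectable W (\<Union>i\<in>(UNIV :: bool set). if i then A else B)"
    using assms by (intro selectable_UN small_countable) auto
  then show ?thesis
    by (simp add: UNIV_bool Un_commute)
qed

lemma selectable_small:
  fixes W :: "nat \<Rightarrow> nat \<Rightarrow> 'a set"
  assumes W: "\<And>n. mono (W n)" and A: "small A" and cover: "\<And>n. A \<subseteq> (\<Union>m. W n m)"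
  shows "selectable W A"
proof -
  have "selectable W {a}" if "a \<in> A" for a
  proof -
    have "\<forall>n. \<exists>m. a \<in> W n m"
      using that cover by blast
    then obtain g where "\<And>n. a \<in> W n (g n)"
      by metis
    then show ?thesis
      unfolding selectable_def by (intro exI[of _ g]) simp
  qed
  then have "selectable W (\<Union>a\<in>A. {a})"
    using W A by (intro selectable_UN)
  then show ?thesis
    by simp
qed

text \<open>By the Lindelof property each cover may be taken countable, and the unions of its first
  members form an increasing cover by sets open in the ambient space.\<close>

lemma menger_spaceI:
  assumes T: "second_countable T" and AT: "A \<subseteq> topspace T"
    and sel: "\<And>W :: nat \<Rightarrow> nat \<Rightarrow> 'a set. (\<And>n m. openin T (W n m)) \<Longrightarrow> (\<And>n. mono (W n)) \<Longrightarrow>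
      (\<And>n. A \<subseteq> (\<Union>m. W n m)) \<Longrightarrow> selectable W A"
  shows "menger_space (subtopology T A)"
  unfolding menger_space_def
proof (intro allI impI)
  fix \<U> :: "nat \<Rightarrow> 'a set set"
  have top: "topspace (subtopology T A) = A"
    using AT by auto
  assume "\<forall>n. (\<forall>U\<in>\<U> n. openin (subtopology T A) U) \<and> \<Union>(\<U> n) = topspace (subtopology T A)"
  then have U: "\<And>n U. U \<in> \<U> n \<Longrightarrow> openin (subtopology T A) U" "\<And>n. \<Union>(\<U> n) = A"
    unfolding top by simp_all
  show "\<exists>\<F>. (\<forall>n. finite (\<F> n) \<and> \<F> n \<subseteq> \<U> n) \<and> (\<Union>n. \<Union>(\<F> n)) = topspace (subtopology T A)"
  proof (cases "A = {}")
    case True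
    then show ?thesis
      by (intro exI[of _ "\<lambda>_. {}"]) simp
  next
    case False
    have "Lindelof_space (subtopology T A)"
      by (intro second_countable_imp_Lindelof_space second_countable_subtopology T)
    then have "\<exists>\<V>. countable \<V> \<and> \<V> \<subseteq> \<U> n \<and> \<Union>\<V> = A" for n
      using U unfolding Lindelof_space_def top by metis
    then obtain \<V> where V: "\<And>n. countable (\<V> n)" "\<And>n. \<V> n \<subseteq> \<U> n" "\<And>n. \<Union>(\<V> n) = A"
      by metis
    define v where "v n = from_nat_into (\<V> n)" for n
    have ne: "\<V> n \<noteq> {}" for n
      using V(3)[of n] False by auto
    have rv: "range (v n) = \<V> n" for n
      by (simp add: v_def range_from_nat_into V(1) ne)
    have vU: "v n i \<in> \<U> n" for n i
      using rv[of n] V(2)[of n] by blast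
    then have "\<exists>O'. openin T O' \<and> v n i = O' \<inter> A" for n i
      using U(1) unfolding openin_subtopology by blast
    then obtain O' where O': "\<And>n i. openin T (O' n i)" "\<And>n i. v n i = O' n i \<inter> A"
      by metis
    have "selectable (\<lambda>n m. \<Union>i\<le>m. O' n i) A"
    proof (rule sel)
      show "openin T (\<Union>i\<le>m. O' n i)" for n m
        using O'(1) by (intro openin_Union) auto
      show "mono (\<lambda>m. \<Union>i\<le>m. O' n i)" for n
        by (rule monoI) force
      have "A \<subseteq> (\<Union>i. v n i)" for n
        using V(3)[of n] rv[of n] by simp
      moreover have "(\<Union>i. v n i) \<subseteq> (\<Union>m. \<Union>i\<le>m. O' n i)" for n
        unfolding O'(2) by auto
      ultimately show "A \<subseteq> (\<Union>m. \<Union>i\<le>m. O' n i)" for n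
        by (meson order_trans)
    qed
    then obtain g where g: "\<And>z. z \<in> A \<Longrightarrow> \<exists>\<^sub>\<infinity>n. z \<in> (\<Union>i\<le>g n. O' n i)"
      unfolding selectable_def by blast
    have "A \<subseteq> (\<Union>n. \<Union>(v n ` {..g n}))"
    proof
      fix z assume "z \<in> A"
      then obtain n where "z \<in> (\<Union>i\<le>g n. O' n i)"
        using g INFM_EX by blast
      then show "z \<in> (\<Union>n. \<Union>(v n ` {..g n}))"
        using \<open>z \<in> A\<close> by (auto simp: O'(2))
    qed
    moreover have "v n i \<subseteq> A" for n i
      by (simp add: O'(2))
    ultimately have "(\<Union>n. \<Union>(v n ` {..g n})) = A"
      by (intro equalityI UN_least Union_least) auto
    moreover have "finite (v n ` {..g n})" "v n ` {..g n} \<subseteq> \<U> n" for n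
      using vU by auto
    ultimately show ?thesis
      unfolding top by (intro exI[of _ "\<lambda>n. v n ` {..g n}"] conjI allI)
  qed
qed

text \<open>The Menger property is applied to each tail of the sequence of covers. The selection at
  stage \<open>n\<close> then takes the largest index demanded by the first \<open>n + 1\<close>
  tails, so each point is caught arbitrarily late.\<close>

lemma menger_space_imp_selectable:
  fixes W :: "nat \<Rightarrow> nat \<Rightarrow> 'a set"
  assumes M: "menger_space T" and op: "\<And>n m. openin T (W n m)" and W: "\<And>n. mono (W n)"
    and cover: "\<And>n. topspace T \<subseteq> (\<Union>m. W n m)"
  shows "selectable W (topspace T)"
proof -
  have "\<exists>g. topspace T \<subseteq> (\<Union>n. W (n + j) (g n))" for j
  proof -
    have "(\<Union>m. W n m) = topspace T" for n
      using cover[of n] op openin_subset by blast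
    then have "\<forall>n. (\<forall>U\<in>range (W (n + j)). openin T U) \<and> \<Union>(range (W (n + j))) = topspace T"
      using op by auto
    with M have "\<exists>\<F>. (\<forall>n. finite (\<F> n) \<and> \<F> n \<subseteq> range (W (n + j))) \<and> (\<Union>n. \<Union>(\<F> n)) = topspace T"
      unfolding menger_space_def by (elim allE[of _ "\<lambda>n. range (W (n + j))"] impE)
    then obtain \<F> where F: "\<And>n. finite (\<F> n)" "\<And>n. \<F> n \<subseteq> range (W (n + j))"
        "(\<Union>n. \<Union>(\<F> n)) = topspace T"
      by auto
    have "\<exists>m. \<Union>(\<F> n) \<subseteq> W (n + j) m" for n
    proof -
      obtain I where I: "finite I" "\<F> n = W (n + j) ` I"
        using F(1,2) finite_subset_image by metis
      have "W (n + j) i \<subseteq> W (n + j) (Max I)" if "i \<in> I" for i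
        using that I(1) W[of "n + j"] by (simp add: monoD)
      then show ?thesis
        using I(2) by (intro exI[of _ "Max I"]) auto
    qed
    then obtain g where "\<And>n. \<Union>(\<F> n) \<subseteq> W (n + j) (g n)"
      by metis
    then have "topspace T \<subseteq> (\<Union>n. W (n + j) (g n))"
      unfolding F(3)[symmetric] by blast
    then show ?thesis
      by blast
  qed
  then obtain g where g: "\<And>j. topspace T \<subseteq> (\<Union>n. W (n + j) (g j n))"
    by metis
  define G where "G n = Max ((\<lambda>j. g j (n - j)) ` {..n})" for n
  have "\<exists>\<^sub>\<infinity>n. z \<in> W n (G n)" if z: "z \<in> topspace T" for z
    unfolding INFM_nat_le
  proof
    fix j
    obtain n where n: "z \<in> W (n + j) (g j n)"
      using g[of j] z by blast
    have "g j (n + j - j) \<le> G (n + j)"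
      unfolding G_def by (intro Max_ge imageI) auto
    then have "z \<in> W (n + j) (G (n + j))"
      using n monoD[OF W[of "n + j"], of "g j n" "G (n + j)"] by auto
    then show "\<exists>n\<ge>j. z \<in> W n (G n)"
      using le_add2 by blast
  qed
  then show ?thesis
    unfolding selectable_def by blast
qed

section \<open>Products for meager semifilters\<close>

text \<open>Pigeonhole: there are \<open>q\<close> disjoint intervals with indices from
  \<open>q\<close> to \<open>2 * q\<close>, all below \<open>f (2 * q)\<close>, but fewer than
  \<open>q\<close> points of \<open>x\<close> there.\<close>

lemma missed_interval:
  fixes f :: "nat \<Rightarrow> nat"
  assumes f: "strict_mono f" and x: "card (x \<inter> {..<f (2 * q)}) < q"
  obtains n where "q \<le> n" "n < 2 * q" "x \<inter> {f n..<f (Suc n)} = {}"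
proof (rule ccontr)
  assume "\<not> thesis"
  then have "\<forall>n\<in>{q..<2 * q}. \<exists>e. e \<in> x \<inter> {f n..<f (Suc n)}"
    using that by (metis atLeastLessThan_iff ex_in_conv)
  then obtain e where e: "\<And>n. n \<in> {q..<2 * q} \<Longrightarrow> e n \<in> x \<inter> {f n..<f (Suc n)}"
    by metis
  have "inj_on e {q..<2 * q}"
  proof (rule inj_onI)
    fix a b assume ab: "a \<in> {q..<2 * q}" "b \<in> {q..<2 * q}" "e a = e b"
    then have "f a < f (Suc b)" "f b < f (Suc a)"
      using e[of a] e[of b] by auto
    then show "a = b"
      using f by (simp add: strict_mono_less)
  qed
  moreover have "e ` {q..<2 * q} \<subseteq> x \<inter> {..<f (2 * q)}"
  proof
    fix u assume "u \<in> e ` {q..<2 * q}"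
    then obtain n where n: "n \<in> {q..<2 * q}" "u = e n" by blast
    then have "f (Suc n) \<le> f (2 * q)"
      using f by (simp add: strict_mono_less_eq)
    then show "u \<in> x \<inter> {..<f (2 * q)}"
      using e[OF n(1)] n(2) by auto
  qed
  ultimately have "card {q..<2 * q} \<le> card (x \<inter> {..<f (2 * q)})"
    by (metis card_image card_mono finite_Int finite_lessThan)
  then show False
    using x by simp
qed

text \<open>The sets \<open>R n m\<close> witness that \<open>y \<mapsto> f y n\<close> is upper semicontinuous, which is what the
  concentration argument needs.\<close>

lemma gap_functions:
  fixes W :: "nat \<Rightarrow> nat \<Rightarrow> (nat set \<times> 'a :: topological_space) set"
  assumes op: "\<And>n m. openin (prod_topology cantor_topology euclidean) (W n m)"
    and W: "\<And>n. mono (W n)"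
    and cover: "\<And>n. fin_sets \<times> Y \<subseteq> (\<Union>m. W n m)"
  obtains f :: "'a \<Rightarrow> nat \<Rightarrow> nat" and R :: "nat \<Rightarrow> nat \<Rightarrow> 'a set"
  where "\<And>n m. open (R n m)" "\<And>y n m. y \<in> Y \<Longrightarrow> f y n \<le> m \<longleftrightarrow> y \<in> R n m"
    "\<And>y. y \<in> Y \<Longrightarrow> strict_mono (f y)"
    "\<And>x y n. y \<in> Y \<Longrightarrow> x \<inter> {f y n..<f y (Suc n)} = {} \<Longrightarrow> (x, y) \<in> W n (f y (Suc n))"
proof -
  \<comment> \<open>\<open>P y n k m\<close> says that at stage \<open>n\<close> the index
    \<open>m\<close> captures, near \<open>y\<close>, every set that follows a subset of
    \<open>{..<k}\<close> and is empty on \<open>{k..<m}\<close>.\<close>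
  define P where "P y n k m \<longleftrightarrow>
    k < m \<and> (\<forall>s\<in>Pow {..<k}. \<exists>V. open V \<and> y \<in> V \<and> cyl s m \<times> V \<subseteq> W n m)" for y n k m
  have WD: "z \<in> W n m" if "z \<in> W n m'" "m' \<le> m" for z n m m'
    using that W[of n] by (auto dest: monoD)
  have P_up: "P y n k m'" if "P y n k m" "m \<le> m'" for y n k m m'
  proof -
    have "\<exists>V. open V \<and> y \<in> V \<and> cyl s m' \<times> V \<subseteq> W n m'" if s: "s \<in> Pow {..<k}" for s
    proof -
      obtain V where V: "open V" "y \<in> V" "cyl s m \<times> V \<subseteq> W n m"
        using \<open>P y n k m\<close> s unfolding P_def by blast
      moreover have "cyl s m' \<times> V \<subseteq> cyl s m \<times> V"
        using cyl_antimono[OF \<open>m \<le> m'\<close>] by blast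
      moreover have "W n m \<subseteq> W n m'"
        using W[of n] \<open>m \<le> m'\<close> by (rule monoD)
      ultimately show ?thesis
        by (meson order_trans)
    qed
    then show ?thesis
      using that unfolding P_def by auto
  qed
  have P_down: "P y n k' m" if "P y n k m" "k' \<le> k" for y n k k' m
  proof -
    have "Pow {..<k'} \<subseteq> Pow {..<k}"
      using that(2) by auto
    then show ?thesis
      using that unfolding P_def by (meson le_less_trans subsetD)
  qed
  have P_ex: "\<exists>m. P y n k m" if y: "y \<in> Y" for y n k
  proof -
    have "\<exists>m V. open V \<and> y \<in> V \<and> cyl s m \<times> V \<subseteq> W n m" if "s \<in> Pow {..<k}" for s
    proof -
      have "finite s"
        using that finite_subset by auto
      then obtain m where "(s, y) \<in> W n m"
        using cover[of n] y by blast
      then obtain U V where UV: "openin cantor_topology U" "openin euclidean V" "s \<in> U" "y \<in> V"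
          "U \<times> V \<subseteq> W n m"
        using op[of n m] unfolding openin_prod_topology_alt by meson
      then obtain j where "cyl s j \<subseteq> U"
        unfolding openin_cantor by blast
      then have "cyl s (max j m) \<subseteq> U"
        using cyl_antimono[of j "max j m"] by fastforce
      moreover have "W n m \<subseteq> W n (max j m)"
        using W[of n] by (simp add: monoD)
      ultimately have "cyl s (max j m) \<times> V \<subseteq> W n (max j m)"
        using UV(5) by blast
      then show ?thesis
        using UV(2,4) by auto
    qed
    then obtain M where M: "\<And>s. s \<in> Pow {..<k} \<Longrightarrow>
        \<exists>V. open V \<and> y \<in> V \<and> cyl s (M s) \<times> V \<subseteq> W n (M s)"
      by metis
    define m where "m = Max (insert (Suc k) (M ` Pow {..<k}))"
    have "Suc k \<le> m"
      unfolding m_def by (intro Max_ge) auto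
    moreover have "\<exists>V. open V \<and> y \<in> V \<and> cyl s m \<times> V \<subseteq> W n m" if s: "s \<in> Pow {..<k}" for s
    proof -
      have le: "M s \<le> m"
        unfolding m_def using s by (intro Max_ge) auto
      obtain V where V: "open V" "y \<in> V" "cyl s (M s) \<times> V \<subseteq> W n (M s)"
        using M[OF s] by blast
      moreover have "cyl s m \<times> V \<subseteq> cyl s (M s) \<times> V"
        using cyl_antimono[OF le] by blast
      moreover have "W n (M s) \<subseteq> W n m"
        using W[of n] le by (rule monoD)
      ultimately show ?thesis
        by (meson order_trans)
    qed
    ultimately show ?thesis
      unfolding P_def by (intro exI[of _ m]) auto
  qed
  have P_open: "open {y. P y n k m}" for n k m
  proof (cases "k < m")
    case True
    have "{y. P y n k m} = (\<Inter>s\<in>Pow {..<k}. \<Union>{V. open V \<and> cyl s m \<times> V \<subseteq> W n m})"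
      using True by (intro set_eqI) (simp add: P_def Bex_def conj_ac)
    moreover have "open (\<Inter>s\<in>Pow {..<k}. \<Union>{V. open V \<and> cyl s m \<times> V \<subseteq> W n m})"
      by (intro open_INT ballI open_Union) auto
    ultimately show ?thesis
      by simp
  qed (simp add: P_def)
  \<comment> \<open>\<open>R n m\<close> collects the points for which a chain of \<open>n\<close>
    captures ends by \<open>m\<close>. The existential over \<open>k\<close> turns each level into a
    union of open sets; \<open>f y n\<close> will be the least such \<open>m\<close>, so
    \<open>f y 0 = 0\<close>.\<close>
  define R where "R = rec_nat (\<lambda>m. UNIV) (\<lambda>n Rn m. {y. \<exists>k. y \<in> Rn k \<and> P y n k m})"
  have R0: "R 0 m = UNIV" for m
    by (simp add: R_def)
  have RS: "R (Suc n) m = {y. \<exists>k. y \<in> R n k \<and> P y n k m}" for n m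
    by (simp add: R_def)
  have R_open: "open (R n m)" for n m
  proof (induction n arbitrary: m)
    case (Suc n)
    have "R (Suc n) m = (\<Union>k. R n k \<inter> {y. P y n k m})"
      unfolding RS by auto
    then show ?case
      using Suc P_open by (simp add: open_UN open_Int)
  qed (simp add: R0)
  have R_up: "y \<in> R n m'" if "y \<in> R n m" "m \<le> m'" for y n m m'
    using that P_up by (cases n) (auto simp: R0 RS)
  have R_ex: "\<exists>m. y \<in> R n m" if "y \<in> Y" for y n
  proof (induction n)
    case (Suc n)
    then show ?case
      using P_ex[OF that, of n] unfolding RS mem_Collect_eq by metis
  qed (simp add: R0)
  define f where "f y n = (LEAST m. y \<in> R n m)" for y n
  have fR: "y \<in> R n (f y n)" if "y \<in> Y" for y n
    unfolding f_def using R_ex[OF that] by (rule LeastI_ex)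
  have f_le: "f y n \<le> m \<longleftrightarrow> y \<in> R n m" if "y \<in> Y" for y n m
  proof
    show "y \<in> R n m" if "f y n \<le> m"
      using fR[OF \<open>y \<in> Y\<close>] that by (rule R_up)
    show "f y n \<le> m" if "y \<in> R n m"
      unfolding f_def using that by (rule Least_le)
  qed
  have fP: "P y n (f y n) (f y (Suc n))" if "y \<in> Y" for y n
  proof -
    obtain k where "y \<in> R n k" "P y n k (f y (Suc n))"
      using fR[OF \<open>y \<in> Y\<close>, of "Suc n"] unfolding RS by blast
    moreover have "f y n \<le> k"
      using f_le[OF \<open>y \<in> Y\<close>] \<open>y \<in> R n k\<close> by simp
    ultimately show ?thesis
      using P_down by simp
  qed
  show ?thesis
  proof
    show "open (R n m)" for n m
      by (rule R_open)
    show "f y n \<le> m \<longleftrightarrow> y \<in> R n m" if "y \<in> Y" for y n m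
      by (rule f_le[OF that])
    show "strict_mono (f y)" if "y \<in> Y" for y
      using fP[OF that] by (simp add: strict_mono_Suc_iff P_def)
    \<comment> \<open>Up to \<open>f y (Suc n)\<close> the set \<open>x\<close> looks like its
      finite part below \<open>f y n\<close>, which is among the captured prefixes.\<close>
    show "(x, y) \<in> W n (f y (Suc n))" if y: "y \<in> Y" and x: "x \<inter> {f y n..<f y (Suc n)} = {}" for x y n
    proof -
      let ?s = "x \<inter> {..<f y n}"
      have "?s \<in> Pow {..<f y n}"
        by blast
      then obtain V where "y \<in> V" "cyl ?s (f y (Suc n)) \<times> V \<subseteq> W n (f y (Suc n))"
        using fP[OF y, of n] unfolding P_def by meson
      moreover have "x \<in> cyl ?s (f y (Suc n))"
        using x by (auto simp: cyl_def not_less)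
      ultimately show ?thesis
        by blast
    qed
  qed
qed

text \<open>The enumeration of a suitable \<open>c\<close> from the scale is itself the selection.
  The condition that \<open>Y0\<close> avoids \<open>D\<close> makes \<open>Y0\<close> empty when
  \<open>Y = D\<close>, which is how single rows are treated later.\<close>

lemma scale_product_selectable:
  fixes W :: "nat \<Rightarrow> nat \<Rightarrow> (nat set \<times> 'a :: topological_space) set"
  assumes S: "semifilter S" and h: "strict_mono h" "\<And>s. s \<in> S \<Longrightarrow> hits h s"
    and X: "semifilter_scale S X"
    and op: "\<And>n m. openin (prod_topology cantor_topology euclidean) (W n m)"
    and W: "\<And>n. mono (W n)"
    and cover: "\<And>n. fin_sets \<times> Y \<subseteq> (\<Union>m. W n m)"
    and D: "countable D" "D \<subseteq> Y" and conc: "\<And>V. open V \<Longrightarrow> D \<subseteq> V \<Longrightarrow> small (Y - V)"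
  obtains X0 Y0 where "small X0" "small Y0" "Y0 \<subseteq> Y - D" "selectable W ((X - X0) \<times> (Y - Y0))"
proof -
  obtain f R where R: "\<And>n m. open (R n m)" "\<And>y n m. y \<in> Y \<Longrightarrow> f y n \<le> m \<longleftrightarrow> y \<in> R n m"
    and f: "\<And>y. y \<in> Y \<Longrightarrow> strict_mono (f y)"
    and fW: "\<And>x y n. y \<in> Y \<Longrightarrow> x \<inter> {f y n..<f y (Suc n)} = {} \<Longrightarrow> (x, y) \<in> W n (f y (Suc n))"
    using gap_functions[of W Y] op W cover by metis
  \<comment> \<open>The shift by 2 reaches past the interval following the one that contains
    \<open>n\<close>; the factor 2 makes room for the pigeonhole argument.\<close>
  define F where "F y n = f y (2 * h (n + 2))" for y n
  obtain g where g: "\<And>y. y \<in> D \<Longrightarrow> \<forall>\<^sub>\<infinity>n. F y n \<le> g n"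
    using small_countable[OF D(1)] unfolding small_def by meson
  obtain b where b: "infinite b" "\<And>n. g n \<le> enumerate b n"
    using infinite_set_above by metis
  obtain c where c: "infinite c" "le_on (semifilter_dual S) b c"
      and X0: "|{x \<in> X. \<not> le_on S c x}| <o bnum_of S"
    using X b(1) unfolding semifilter_scale_def by auto
  define X0 where "X0 = {x \<in> X. \<not> le_on S c x}"
  define Y0 where "Y0 = {y \<in> Y. \<not> (\<exists>\<^sub>\<infinity>n. F y n \<le> enumerate c n)}"
  have "small X0"
    unfolding X0_def by (rule small_if_less_bnum_of[OF S h X0])
  \<comment> \<open>Members of the dual are infinite. So \<open>b\<close> is below \<open>c\<close>
    infinitely often, and with \<open>F y\<close> almost everywhere below \<open>b\<close> this
    reaches every \<open>y\<close> in \<open>D\<close>.\<close>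
  have "infinite {n. enumerate b n \<le> enumerate c n}"
    using c(2) unfolding le_on_def semifilter_dual_def by blast
  then have bc: "\<exists>\<^sub>\<infinity>n. enumerate b n \<le> enumerate c n"
    by (simp add: INFM_iff_infinite)
  have DF: "\<exists>\<^sub>\<infinity>n. F y n \<le> enumerate c n" if "y \<in> D" for y
    using INFM_conjI[OF bc g[OF that]]
    by (rule INFM_mono) (meson b(2) order_trans)
  have "small Y0"
  proof -
    \<comment> \<open>Through \<open>R\<close> the inequality
      \<open>F y n \<le> enumerate c n\<close> is an open condition on \<open>y\<close>, so
      concentration applies to each \<open>V N\<close>.\<close>
    define V where "V N = (\<Union>n\<in>{N..}. R (2 * h (n + 2)) (enumerate c n))" for N
    have V: "y \<in> V N \<longleftrightarrow> (\<exists>n\<ge>N. F y n \<le> enumerate c n)" if "y \<in> Y" for y N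
      using that by (auto simp: V_def F_def R(2))
    have "small (Y - V N)" for N
    proof (rule conc)
      show "open (V N)"
        unfolding V_def using R(1) by blast
      show "D \<subseteq> V N"
      proof
        fix y assume "y \<in> D"
        then show "y \<in> V N"
          using DF[of y] D(2) V[of y N] unfolding INFM_nat_le by auto
      qed
    qed
    then have "small (\<Union>N. Y - V N)"
      by (rule small_UN_nat)
    moreover have "Y0 \<subseteq> (\<Union>N. Y - V N)"
    proof
      fix y assume "y \<in> Y0"
      then have y: "y \<in> Y" "\<not> (\<forall>N. \<exists>n\<ge>N. F y n \<le> enumerate c n)"
        unfolding Y0_def INFM_nat_le by simp_all
      then obtain N where "y \<notin> V N"
        using V[OF y(1)] by blast
      with y(1) show "y \<in> (\<Union>N. Y - V N)"
        by blast
    qed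
    ultimately show ?thesis
      by (rule small_subset)
  qed
  have "Y0 \<subseteq> Y - D"
    using DF unfolding Y0_def by blast
  have "\<exists>\<^sub>\<infinity>n. (x, y) \<in> W n (enumerate c n)" if x: "x \<in> X - X0" and y: "y \<in> Y - Y0" for x y
  proof -
    have "infinite x"
      using x X unfolding semifilter_scale_def by blast
    have "y \<in> Y" and inf: "\<exists>\<^sub>\<infinity>n. F y n \<le> enumerate c n"
      using y by (auto simp: Y0_def)
    have "hits h {n. enumerate c n \<le> enumerate x n}"
      using x h(2) by (simp add: X0_def le_on_def)
    then obtain K where K: "\<And>k. K \<le> k \<Longrightarrow> {n. enumerate c n \<le> enumerate x n} \<inter> {h k..<h (Suc k)} \<noteq> {}"
      unfolding hits_def MOST_nat_le by blast
    show ?thesis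
      unfolding INFM_nat_le
    proof
      fix N
      obtain n where n: "max (h K) N \<le> n" "F y n \<le> enumerate c n"
        using inf unfolding INFM_nat_le by blast
      \<comment> \<open>The interval containing \<open>n\<close>; it exists because
        \<open>h 0 \<le> h K \<le> n\<close>.\<close>
      obtain k where k: "h k \<le> n" "n < h (Suc k)"
      proof -
        define k where "k = (LEAST j. n < h (Suc j))"
        have "n < h (Suc n)"
          using strict_mono_imp_increasing[OF h(1), of "Suc n"] by simp
        then have "n < h (Suc k)"
          unfolding k_def by (rule LeastI)
        moreover have "h k \<le> n"
        proof (cases k)
          case 0
          then show ?thesis
            using n(1) h(1) by (meson le0 le_trans max.bounded_iff strict_mono_less_eq)
        next
          case (Suc j)
          then show ?thesis
            using not_less_Least[of j "\<lambda>j. n < h (Suc j)"] by (simp add: k_def)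
        qed
        ultimately show ?thesis
          using that by blast
      qed
      have "h K < h (Suc k)"
        using n(1) k(2) by simp
      then have "K \<le> Suc k"
        using h(1) by (simp add: strict_mono_less)
      \<comment> \<open>The hit is taken in the next interval, so that \<open>m\<close> lies beyond
        \<open>n\<close> and the bound at \<open>n\<close> passes to \<open>enumerate x m\<close>.
        Hence \<open>x\<close> has at most \<open>m < h (k + 2)\<close> elements below
        \<open>f y (2 * h (k + 2))\<close> and misses one of the intervals of
        \<open>f y\<close>.\<close>
      then obtain m where m: "enumerate c m \<le> enumerate x m" "h (Suc k) \<le> m" "m < h (k + 2)"
        using K by fastforce
      let ?q = "h (k + 2)"
      have "k \<le> n"
        using k(1) strict_mono_imp_increasing[OF h(1), of k] by simp
      then have "?q \<le> h (n + 2)"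
        using h(1) by (simp add: strict_mono_less_eq)
      then have "f y (2 * ?q) \<le> F y n"
        unfolding F_def using f[OF \<open>y \<in> Y\<close>] by (simp add: strict_mono_less_eq)
      with n(2) have fc: "f y (2 * ?q) \<le> enumerate c n"
        by simp
      also have "\<dots> \<le> enumerate c m"
        using k(2) m(2) c(1) by simp
      also have "\<dots> \<le> enumerate x m"
        by (rule m(1))
      finally have "\<not> m < card (x \<inter> {..<f y (2 * ?q)})"
        using \<open>infinite x\<close> by (simp flip: enumerate_less_iff)
      then have "card (x \<inter> {..<f y (2 * ?q)}) < ?q"
        using m(3) by simp
      then obtain j where j: "?q \<le> j" "j < 2 * ?q" "x \<inter> {f y j..<f y (Suc j)} = {}"
        using missed_interval f[OF \<open>y \<in> Y\<close>] by metis
      have "n \<le> j"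
        using k(2) m(2,3) j(1) by simp
      have "f y (Suc j) \<le> f y (2 * ?q)"
        using j(2) f[OF \<open>y \<in> Y\<close>] by (simp add: strict_mono_less_eq)
      also note fc
      also have "enumerate c n \<le> enumerate c j"
        using \<open>n \<le> j\<close> c(1) by simp
      finally have "W j (f y (Suc j)) \<subseteq> W j (enumerate c j)"
        using W[of j] by (simp add: monoD)
      then have "(x, y) \<in> W j (enumerate c j)"
        using fW[OF \<open>y \<in> Y\<close> j(3)] by blast
      then show "\<exists>j\<ge>N. (x, y) \<in> W j (enumerate c j)"
        using n(1) \<open>n \<le> j\<close> by (intro exI[of _ j]) simp
    qed
  qed
  then have "selectable W ((X - X0) \<times> (Y - Y0))"
    unfolding selectable_def by (intro exI[of _ "enumerate c"]) auto
  then show ?thesis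
    using that \<open>small X0\<close> \<open>small Y0\<close> \<open>Y0 \<subseteq> Y - D\<close> by blast
qed

text \<open>A selection for the countable set \<open>D\<close> covers, from each stage on, an open
  set around \<open>D\<close>. The points that escape form a countable union of small sets and
  receive a selection of their own.\<close>

lemma concentrated_selectable:
  fixes W :: "nat \<Rightarrow> nat \<Rightarrow> 'a :: topological_space set"
  assumes op: "\<And>n m. open (W n m)" and W: "\<And>n. mono (W n)" and cover: "\<And>n. Y \<subseteq> (\<Union>m. W n m)"
    and D: "countable D" "D \<subseteq> Y" and conc: "\<And>V. open V \<Longrightarrow> D \<subseteq> V \<Longrightarrow> small (Y - V)"
  shows "selectable W Y"
proof -
  have "selectable W D"
    using D cover by (intro selectable_small W small_countable) auto
  then obtain g where g: "\<And>y. y \<in> D \<Longrightarrow> \<exists>\<^sub>\<infinity>n. y \<in> W n (g n)"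
    unfolding selectable_def by blast
  define V where "V N = (\<Union>n\<in>{N..}. W n (g n))" for N
  have "small (Y - V N)" for N
  proof (rule conc)
    show "open (V N)"
      unfolding V_def using op by blast
    show "D \<subseteq> V N"
      using g unfolding V_def INFM_nat_le by force
  qed
  then have "small (\<Union>N. Y - V N)"
    by (rule small_UN_nat)
  then have "selectable W (\<Union>N. Y - V N)"
    using cover by (intro selectable_small W) auto
  moreover have "selectable W (Y - (\<Union>N. Y - V N))"
    unfolding selectable_def V_def INFM_nat_le by (intro exI[of _ g]) auto
  ultimately have "selectable W ((\<Union>N. Y - V N) \<union> (Y - (\<Union>N. Y - V N)))"
    by (intro selectable_Un W)
  then show ?thesis
    by (rule selectable_subset) blast
qed

lemma meager_imp_menger_product:
  assumes bd: "bnum =o dnum" and S: "semifilter S" and M: "meager_in cantor_topology S"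
    and X: "semifilter_scale S X" and Y: "concentrated dnum (top_of_set Y)"
  shows "menger_space (prod_topology (subtopology cantor_topology (X \<union> fin_sets))
    (top_of_set (Y :: 'a :: second_countable_topology set)))"
proof -
  obtain h where h: "strict_mono h" "\<And>s. s \<in> S \<Longrightarrow> hits h s"
    using meager_semifilter_imp_hits[OF S M] by metis
  obtain D where D: "countable D" "D \<subseteq> Y"
      and conc': "\<And>U. openin (top_of_set Y) U \<Longrightarrow> D \<subseteq> U \<Longrightarrow> |Y - U| <o dnum"
    using Y unfolding concentrated_def by auto
  have conc: "small (Y - V)" if "open V" "D \<subseteq> V" for V
  proof -
    have "openin (top_of_set Y) (Y \<inter> V)"
      using that(1) by blast
    then have "|Y - Y \<inter> V| <o dnum"
      using D(2) that(2) by (intro conc') auto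
    then have "|Y - Y \<inter> V| <o bnum"
      using bd ordIso_symmetric ordLess_ordIso_trans by blast
    then have "small (Y - Y \<inter> V)"
      by (rule small_if_less_bnum)
    then show ?thesis
      by (rule small_subset) blast
  qed
  let ?Z = "(X \<union> fin_sets) \<times> Y"
  let ?T = "prod_topology cantor_topology (euclidean :: 'a topology)"
  have "menger_space (subtopology ?T ?Z)"
  proof (rule menger_spaceI)
    show "second_countable ?T"
      by (intro second_countable_prod_topology second_countable_cantor second_countable_euclidean)
    fix W :: "nat \<Rightarrow> nat \<Rightarrow> (nat set \<times> 'a) set"
    assume op: "\<And>n m. openin ?T (W n m)" and W: "\<And>n. mono (W n)" and cover: "\<And>n. ?Z \<subseteq> (\<Union>m. W n m)"
    have fin: "countable fin_sets"
      by (rule countable_Collect_finite)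
    have cover_fin: "fin_sets \<times> Y' \<subseteq> (\<Union>m. W n m)" if "Y' \<subseteq> Y" for Y' n
      using cover[of n] that by blast
    have vertical: "selectable W ({x} \<times> Y)" if "x \<in> X \<union> fin_sets" for x
    proof -
      have "open {y. (x, y) \<in> W n m}" for n m
      proof -
        have "continuous_map euclidean ?T (Pair x)"
          by (intro continuous_map_pairedI) auto
        then show ?thesis
          using openin_continuous_map_preimage[OF _ op[of n m]] by fastforce
      qed
      moreover have "mono (\<lambda>m. {y. (x, y) \<in> W n m})" for n
        using W[of n] by (auto simp: mono_def)
      moreover have "Y \<subseteq> (\<Union>m. {y. (x, y) \<in> W n m})" for n
        using cover[of n] that by blast
      ultimately have "selectable (\<lambda>n m. {y. (x, y) \<in> W n m}) Y"
        using D conc by (rule concentrated_selectable)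
      then show ?thesis
        unfolding selectable_def by auto
    qed
    have small_vertical: "selectable W (A \<times> Y)" if "small A" "A \<subseteq> X \<union> fin_sets" for A
    proof -
      have "selectable W (\<Union>x\<in>A. {x} \<times> Y)"
        using that vertical by (intro selectable_UN W) auto
      then show ?thesis
        by (rule selectable_subset) blast
    qed
    \<comment> \<open>With \<open>{y}\<close> as both the second factor and its concentration set,
      no row is exceptional; the exceptional columns are small and are covered by
      \<open>small_vertical\<close>.\<close>
    have horizontal: "selectable W ((X \<union> fin_sets) \<times> {y})" if y: "y \<in> Y" for y
    proof -
      obtain X0 Y0 where X0: "small X0" "Y0 \<subseteq> {y} - {y}" "selectable W ((X - X0) \<times> ({y} - Y0))"
      proof -
        have "countable {y}" "{y} \<subseteq> {y}" "{y} \<subseteq> Y" "\<And>V. {y} \<subseteq> V \<Longrightarrow> small ({y} - V)"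
          using y by (auto intro: small_countable)
        from scale_product_selectable[where W = W, OF S h X op W cover_fin[OF this(3)] this(1,2,4)]
        obtain X0 Y0 where "small X0" "Y0 \<subseteq> {y} - {y}" "selectable W ((X - X0) \<times> ({y} - Y0))"
          by metis
        then show thesis by (rule that)
      qed
      have "small ((X0 \<inter> X) \<union> fin_sets)"
        using X0(1) fin by (intro small_Un small_countable[of fin_sets]) (auto intro: small_subset)
      then have "selectable W (((X0 \<inter> X) \<union> fin_sets) \<times> Y)"
        by (rule small_vertical) blast
      then have "selectable W (((X0 \<inter> X) \<union> fin_sets) \<times> Y \<union> (X - X0) \<times> ({y} - Y0))"
        using X0(3) W by (intro selectable_Un)
      then show ?thesis
        by (rule selectable_subset) (use X0(2) y in auto)
    qed
    obtain X0 Y0 where X0: "small X0" "small Y0" "Y0 \<subseteq> Y - D" "selectable W ((X - X0) \<times> (Y - Y0))"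
      using scale_product_selectable[where W = W, OF S h X op W cover_fin[OF order_refl] D conc] by metis
    have "small ((X0 \<inter> X) \<union> fin_sets)"
      using X0(1) fin by (intro small_Un small_countable[of fin_sets]) (auto intro: small_subset)
    then have 1: "selectable W (((X0 \<inter> X) \<union> fin_sets) \<times> Y)"
      by (rule small_vertical) blast
    have 2: "selectable W (\<Union>y\<in>Y0. (X \<union> fin_sets) \<times> {y})"
      using X0(2,3) horizontal by (intro selectable_UN W) auto
    \<comment> \<open>The product splits into a small set of columns, a small set of rows and the
      remaining rectangle.\<close>
    have "selectable W ((X0 \<inter> X \<union> fin_sets) \<times> Y \<union>
        ((\<Union>y\<in>Y0. (X \<union> fin_sets) \<times> {y}) \<union> (X - X0) \<times> (Y - Y0)))"
      using 1 2 X0(4) W by (intro selectable_Un)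
    then show "selectable W ?Z"
      by (rule selectable_subset) auto
  qed auto
  then show ?thesis
    by (simp add: subtopology_Times)
qed

section \<open>Products for nonmeager semifilters\<close>

text \<open>The first elements of the maximal runs of consecutive numbers. They can grow fast even
  when \<open>x\<close> contains long runs, and they depend continuously on
  \<open>x\<close>.\<close>

definition starts :: "nat set \<Rightarrow> nat set" where
  "starts x = {p \<in> x. p = 0 \<or> p - 1 \<notin> x}"

text \<open>The enumeration \<open>X\<close> of the required set jumps above \<open>c\<close> at every step, except on the
  intervals \<open>{h k..<h (Suc k)}\<close> missed by some \<open>s \<in> S\<close>, where it runs through consecutive numbers.
  The jumps yield \<open>c \<le>\<^sub>S x\<close> and make the starts grow, the runs create long gaps in \<open>- x\<close>.\<close>

lemma nonmeager_block_set:
  assumes S: "semifilter S" and nm: "\<not> meager_in cantor_topology S" and c: "infinite c"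
  obtains x where "infinite x" "le_on S c x" "infinite (starts x)"
    "\<And>n. enumerate c n \<le> enumerate (starts x) n" "infinite (- x)" "\<not> - x \<le>\<^sup>* c"
proof -
  let ?C = "enumerate c"
  \<comment> \<open>\<open>B\<close> is the sequence obtained by jumping at every step, an upper
    bound for the later \<open>X\<close> fixed before \<open>s\<close> is known. The intervals of
    \<open>h\<close> must be long compared with it, and \<open>s\<close> is chosen only after
    \<open>h\<close>.\<close>
  define B where "B = rec_nat (?C 0) (\<lambda>n b. b + 2 + ?C (Suc n))"
  define h where "h = rec_nat 0 (\<lambda>k m. Suc (m + ?C (B m)))"
  have B: "B 0 = ?C 0" "B (Suc n) = B n + 2 + ?C (Suc n)" for n
    by (simp_all add: B_def)
  have h: "h 0 = 0" "h (Suc k) = Suc (h k + ?C (B (h k)))" for k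
    by (simp_all add: h_def)
  have hm: "strict_mono h"
    by (simp add: strict_mono_Suc_iff h)
  obtain s where s: "s \<in> S" "\<not> hits h s"
    using nonmeager_imp_not_hits[OF nm hm] by metis
  define run where "run n \<longleftrightarrow>
    (\<exists>k. h k \<le> n \<and> Suc n < h (Suc k) \<and> s \<inter> {h k..<h (Suc k)} = {})" for n
  \<comment> \<open>The summand 2 leaves a hole just before the new value, so a jump begins a new
    run.\<close>
  define X where "X = rec_nat (?C 0) (\<lambda>n v. if run n then Suc v else v + 2 + ?C (Suc n))"
  have X: "X 0 = ?C 0" "X (Suc n) = (if run n then Suc (X n) else X n + 2 + ?C (Suc n))" for n
    by (simp_all add: X_def)
  have Xm: "strict_mono X"
    by (simp add: strict_mono_Suc_iff X)
  have XB: "X n \<le> B n" for n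
    by (induction n) (auto simp: X B)
  define x where "x = range X"
  have ix: "infinite x" and ex: "enumerate x = X"
    unfolding x_def using enumerate_range[OF Xm] by auto
  \<comment> \<open>The indices reached by a jump, with 0 included. They contain \<open>s\<close>,
    since runs stay within intervals missed by \<open>s\<close>, and their values are the
    starts.\<close>
  define J where "J = {n. n = 0 \<or> \<not> run (n - 1)}"
  have CJ: "?C n \<le> X n" if "n \<in> J" for n
    using that by (cases n) (auto simp: X J_def)
  have "s \<subseteq> J"
  proof
    fix n assume "n \<in> s"
    have "\<not> run (n - 1)" if "n \<noteq> 0"
    proof
      assume "run (n - 1)"
      then obtain k where "h k \<le> n - 1" "Suc (n - 1) < h (Suc k)" "s \<inter> {h k..<h (Suc k)} = {}"
        unfolding run_def by blast
      then have "n \<in> s \<inter> {h k..<h (Suc k)}"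
        using \<open>n \<in> s\<close> that by auto
      with \<open>s \<inter> {h k..<h (Suc k)} = {}\<close> show False
        by blast
    qed
    then show "n \<in> J"
      by (auto simp: J_def)
  qed
  then have sub: "s \<subseteq> {n. ?C n \<le> enumerate x n}"
    using CJ unfolding ex by blast
  moreover have "infinite s"
    using s(1) S unfolding semifilter_def by blast
  ultimately have "infinite {n. ?C n \<le> enumerate x n}"
    using finite_subset by blast
  moreover have "s \<subseteq>\<^sup>* {n. ?C n \<le> enumerate x n}"
    using sub unfolding almost_subset_def by (metis Diff_eq_empty_iff finite.emptyI)
  ultimately have le: "le_on S c x"
    using S s(1) unfolding semifilter_def le_on_def by blast
  \<comment> \<open>The strict bound \<open>Suc n < h (Suc k)\<close> in \<open>run\<close> makes
    the step onto the first index of an interval a jump.\<close>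
  have "range h \<subseteq> J"
  proof
    fix n assume "n \<in> range h"
    then obtain k where n: "n = h k" by blast
    have False if "n \<noteq> 0" and run: "run (n - 1)"
    proof -
      obtain l where "h l \<le> n - 1" "Suc (n - 1) < h (Suc l)"
        using run unfolding run_def by blast
      then have "h l < h k" "h k < h (Suc l)"
        using \<open>n \<noteq> 0\<close> n by auto
      then show False
        using hm by (simp add: strict_mono_less)
    qed
    then show "n \<in> J"
      by (auto simp: J_def)
  qed
  then have iJ: "infinite J"
    using enumerate_range(1)[OF hm] finite_subset by blast
  have pred: "X n - 1 \<notin> x" if n: "n \<in> J" "X n \<noteq> 0" for n
  proof
    assume "X n - 1 \<in> x"
    then obtain i where i: "X i = X n - 1"
      unfolding x_def by (metis imageE)
    then have "X i < X n"
      using n(2) by simp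
    then have "i < n"
      using Xm by (simp add: strict_mono_less)
    then obtain j where j: "n = Suc j"
      by (cases n) auto
    then have "X i \<le> X j"
      using Xm \<open>i < n\<close> by (simp add: strict_mono_less_eq)
    moreover have "X n = X j + 2 + ?C (Suc j)"
      using n(1) j X by (simp add: J_def)
    ultimately show False
      using i by simp
  qed
  have starts: "starts x = X ` J"
  proof
    show "X ` J \<subseteq> starts x"
      using pred unfolding starts_def x_def by auto
    show "starts x \<subseteq> X ` J"
    proof
      fix p assume p: "p \<in> starts x"
      then obtain n where n: "p = X n"
        unfolding starts_def x_def by blast
      have "n \<in> J"
      proof (rule ccontr)
        assume "n \<notin> J"
        then obtain j where "n = Suc j" "run j"
          by (cases n) (auto simp: J_def)
        then have "p = Suc (X j)"
          using n X by simp
        then show False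
          using p by (auto simp: starts_def x_def)
      qed
      then show "p \<in> X ` J"
        using n by blast
    qed
  qed
  have ist: "infinite (starts x)"
    unfolding starts using iJ Xm by (simp add: finite_image_iff strict_mono_imp_inj_on inj_on_subset)
  have Cstarts: "?C n \<le> enumerate (starts x) n" for n
  proof -
    \<comment> \<open>A start below \<open>?C n\<close> has an index \<open>i\<close> with
      \<open>?C i \<le> X i < ?C n\<close>, hence \<open>i < n\<close>; so at most \<open>n\<close>
      starts lie there.\<close>
    have "starts x \<inter> {..<?C n} \<subseteq> X ` {..<n}"
    proof
      fix p assume "p \<in> starts x \<inter> {..<?C n}"
      then obtain i where i: "i \<in> J" "p = X i" "X i < ?C n"
        unfolding starts by auto
      then have "?C i < ?C n"
        using CJ le_less_trans by blast
      then have "i < n"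
        using c by simp
      then show "p \<in> X ` {..<n}"
        using i by blast
    qed
    then have "card (starts x \<inter> {..<?C n}) \<le> card (X ` {..<n})"
      by (intro card_mono) auto
    also have "\<dots> \<le> n"
      using card_image_le[of "{..<n}" X] by simp
    finally show ?thesis
      using enumerate_less_iff[OF ist, of n "?C n"] by simp
  qed
  have icx: "infinite (- x)"
  proof
    assume "finite (- x)"
    then obtain N where N: "- x \<subseteq> {..<N}"
      using finite_nat_bounded by blast
    obtain n where n: "n \<in> J" "Suc N < n"
      using iJ infinite_nat_iff_unbounded by blast
    moreover have "n \<le> X n"
      using strict_mono_imp_increasing[OF Xm] .
    ultimately have "X n - 1 \<notin> x" "X n - 1 \<notin> {..<N}"
      using pred by auto
    then show False
      using N by blast
  qed
  have "\<exists>\<^sub>\<infinity>m. \<not> enumerate (- x) m \<le> ?C m"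
    unfolding INFM_nat_le
  proof
    fix M
    obtain k where k: "Suc (enumerate (- x) M) \<le> k" "s \<inter> {h k..<h (Suc k)} = {}"
      using s(2) unfolding hits_def MOST_nat_le by blast
    define p where "p = X (h k)"
    define L where "L = h (Suc k) - h k"
    have run: "X (h k + i) = p + i" if "i < L" for i
      using that
    proof (induction i)
      case (Suc i)
      have "run (h k + i)"
        unfolding run_def using Suc.prems k(2) by (intro exI[of _ k]) (auto simp: L_def)
      then show ?case
        using Suc X by simp
    qed (simp add: p_def)
    \<comment> \<open>The element of \<open>- x\<close> with index \<open>m\<close> is its first one
      after the run of length \<open>L\<close> at \<open>p\<close>. As
      \<open>m \<le> p \<le> B (h k)\<close>, the choice of \<open>h\<close> gives
      \<open>?C m < L\<close>.\<close>
    define m where "m = card (- x \<inter> {..<p})"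
    have "- x \<inter> {..<p + L} = - x \<inter> {..<p}"
    proof -
      have "q \<in> x" if "p \<le> q" "q < p + L" for q
        using run[of "q - p"] that unfolding x_def by (metis add_diff_inverse_nat leD less_diff_conv2 add.commute rangeI)
      then show ?thesis
        by (auto simp flip: not_le)
    qed
    then have 1: "p + L \<le> enumerate (- x) m"
      using enumerate_less_iff[OF icx, of m "p + L"] by (simp add: m_def)
    have "k \<le> h k" "h k \<le> p"
      unfolding p_def by (rule strict_mono_imp_increasing[OF hm] strict_mono_imp_increasing[OF Xm])+
    then have "enumerate (- x) M < p"
      using k(1) by simp
    then have "M < m"
      using enumerate_less_iff[OF icx] by (simp add: m_def)
    have "m \<le> card {..<p}"
      unfolding m_def by (intro card_mono) auto
    then have "m \<le> B (h k)"
      using XB[of "h k"] by (simp add: p_def)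
    then have "?C m \<le> ?C (B (h k))"
      using c by simp
    also have "\<dots> < L"
      by (simp add: L_def h)
    finally have "\<not> enumerate (- x) m \<le> ?C m"
      using 1 by simp
    then show "\<exists>m\<ge>M. \<not> enumerate (- x) m \<le> ?C m"
      using \<open>M < m\<close> less_imp_le by blast
  qed
  then have "\<not> - x \<le>\<^sup>* c"
    unfolding le_star_def by (simp add: not_MOST)
  then show ?thesis
    using that[OF ix le ist Cstarts icx] by blast
qed

lemma openin_starts: "openin cantor_topology {x. n < card (starts x \<inter> {..<m})}"
  unfolding openin_cantor
proof
  fix a assume a: "a \<in> {x. n < card (starts x \<inter> {..<m})}"
  have "starts x \<inter> {..<m} = starts a \<inter> {..<m}" if "x \<in> cyl a m" for x
  proof (intro set_eqI)
    fix p
    have "p < m \<Longrightarrow> p \<in> x \<longleftrightarrow> p \<in> a" "p < m \<Longrightarrow> p - 1 \<in> x \<longleftrightarrow> p - 1 \<in> a"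
      using that by (auto simp: cyl_def)
    then show "p \<in> starts x \<inter> {..<m} \<longleftrightarrow> p \<in> starts a \<inter> {..<m}"
      by (auto simp: starts_def)
  qed
  then show "\<exists>m'. cyl a m' \<subseteq> {x. n < card (starts x \<inter> {..<m})}"
    using a by (metis (no_types, lifting) mem_Collect_eq subsetI)
qed

text \<open>After complementation \<open>V\<close> surrounds all finite sets, so gap functions yield
  intervals one of which must be missed only by complements of members of \<open>V\<close>. Outside
  \<open>V\<close> the complement meets every interval, which bounds its enumeration by the
  endpoints.\<close>

lemma open_superset_of_cofinite:
  assumes V: "openin cantor_topology V" and cof: "\<And>a. finite (- a) \<Longrightarrow> a \<in> V"
  obtains u where "infinite u" "\<And>x. infinite (- x) \<Longrightarrow> x \<notin> V \<Longrightarrow> - x \<le>\<^sup>* u"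
proof -
  have V': "openin cantor_topology {x. - x \<in> V}"
    unfolding openin_cantor
  proof
    fix a assume "a \<in> {x. - x \<in> V}"
    then obtain m where "cyl (- a) m \<subseteq> V"
      using V unfolding openin_cantor by blast
    moreover have "- x \<in> cyl (- a) m" if "x \<in> cyl a m" for x
      using that by (simp add: cyl_def)
    ultimately show "\<exists>m. cyl a m \<subseteq> {x. - x \<in> V}"
      by blast
  qed
  \<comment> \<open>A constant sequence of covers; the real factor is a dummy, evaluated at the
    point 0.\<close>
  let ?W = "\<lambda>(n::nat) (m::nat). {x. - x \<in> V} \<times> (UNIV :: real set)"
  have op: "openin (prod_topology cantor_topology euclidean) (?W n m)" for n m
    using V' by (simp add: openin_prod_Times_iff)
  have mono: "mono (?W n)" for n
    by (simp add: mono_def)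
  have cover: "fin_sets \<times> {0::real} \<subseteq> (\<Union>m. ?W n m)" for n
    using cof by auto
  obtain f :: "real \<Rightarrow> nat \<Rightarrow> nat" where f: "strict_mono (f 0)"
      "\<And>x n. x \<inter> {f 0 n..<f 0 (Suc n)} = {} \<Longrightarrow> - x \<in> V"
  proof (rule gap_functions[where W = ?W, OF op mono cover])
    fix f :: "real \<Rightarrow> nat \<Rightarrow> nat" and R :: "nat \<Rightarrow> nat \<Rightarrow> real set"
    assume f: "\<And>y. y \<in> {0} \<Longrightarrow> strict_mono (f y)"
      "\<And>x y n. y \<in> {0} \<Longrightarrow> x \<inter> {f y n..<f y (Suc n)} = {} \<Longrightarrow> (x, y) \<in> ?W n (f y (Suc n))"
    show thesis
      by (rule that[of f]) (use f(1)[of 0] f(2)[of 0] in auto)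
  qed
  define F where "F = f 0"
  have F: "strict_mono F" "\<And>x n. x \<inter> {F n..<F (Suc n)} = {} \<Longrightarrow> - x \<in> V"
    using f by (auto simp: F_def)
  have sm: "strict_mono (\<lambda>n. F (Suc n))"
    using F(1) by (simp add: strict_mono_Suc_iff)
  have "- x \<le>\<^sup>* range (\<lambda>n. F (Suc n))" if x: "infinite (- x)" "x \<notin> V" for x
  proof -
    have ne: "- x \<inter> {F n..<F (Suc n)} \<noteq> {}" for n
      using F(2)[of "- x" n] x(2) by auto
    have "n < card (- x \<inter> {..<F (Suc n)})" for n
    proof -
      have "n \<le> card (- x \<inter> {..<F n})" for n
      proof (induction n)
        case (Suc n)
        have "F n < F (Suc n)"
          using F(1) by (simp add: strict_mono_less)
        then have "- x \<inter> {..<F n} \<subset> - x \<inter> {..<F (Suc n)}"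
        proof (intro psubsetI)
          show "- x \<inter> {..<F n} \<subseteq> - x \<inter> {..<F (Suc n)}"
            using \<open>F n < F (Suc n)\<close> by auto
          obtain p where "p \<in> - x \<inter> {F n..<F (Suc n)}"
            using ne[of n] by blast
          then have "p \<in> - x \<inter> {..<F (Suc n)}" "p \<notin> - x \<inter> {..<F n}"
            by auto
          then show "- x \<inter> {..<F n} \<noteq> - x \<inter> {..<F (Suc n)}"
            by blast
        qed
        then have "card (- x \<inter> {..<F n}) < card (- x \<inter> {..<F (Suc n)})"
          by (intro psubset_card_mono) auto
        then show ?case
          using Suc by simp
      qed simp
      then show ?thesis
        using Suc_le_eq by blast
    qed
    then have "enumerate (- x) n < F (Suc n)" for n
      by (simp add: enumerate_less_iff[OF x(1)])
    then show ?thesis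
      unfolding le_star_def enumerate_range(2)[OF sm] by (simp add: less_imp_le)
  qed
  then show ?thesis
    using that[OF enumerate_range(1)[OF sm]] by blast
qed

section \<open>Embedding the Cantor space into the real line\<close>

text \<open>The base 3 expansion with digits 0 and 1 embeds the Cantor space into the real line.\<close>

definition ternary :: "nat set \<Rightarrow> real" where
  "ternary a = (\<Sum>i. if i \<in> a then (1/3)^i else 0)"

lemma ternary_split:
  obtains t where "ternary a = (\<Sum>i<n. if i \<in> a then (1/3)^i else 0) + t"
    "0 \<le> t" "t \<le> 3/2 * (1/3)^n"
proof -
  let ?d = "\<lambda>i. if i \<in> a then (1/3)^i else 0 :: real"
  have geo: "summable (\<lambda>i. (1/3)^n * (1/3)^i :: real)"
    by (intro summable_mult summable_geometric) simp
  have d: "summable ?d"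
    by (rule summable_comparison_test'[of "\<lambda>i. (1/3)^i :: real" 0]) (auto simp: summable_geometric)
  have d': "summable (\<lambda>i. ?d (i + n))"
    using d by (subst summable_iff_shift)
  have "(\<Sum>i. ?d (i + n)) \<le> (\<Sum>i. (1/3)^n * (1/3)^i)"
    using d' geo by (intro suminf_le) (auto simp: power_add)
  also have "\<dots> = (1/3)^n * (\<Sum>i. (1/3)^i)"
    by (intro suminf_mult summable_geometric) simp
  also have "\<dots> = 3/2 * (1/3)^n"
    by (simp add: suminf_geometric)
  finally have "(\<Sum>i. ?d (i + n)) \<le> 3/2 * (1/3)^n" .
  moreover have "0 \<le> (\<Sum>i. ?d (i + n))"
    using d' by (intro suminf_nonneg) auto
  moreover have "ternary a = (\<Sum>i<n. ?d i) + (\<Sum>i. ?d (i + n))"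
    unfolding ternary_def using suminf_split_initial_segment[OF d, of n] by simp
  ultimately show ?thesis
    using that by blast
qed

text \<open>At the first difference one expansion gains \<open>(1/3)^n\<close>, while the tail of
  the other is at most half of that.\<close>

lemma inj_ternary: "inj ternary"
proof (rule injI, rule ccontr)
  have *: "ternary a \<noteq> ternary b"
    if n: "n \<in> a" "n \<notin> b" "\<And>i. i < n \<Longrightarrow> i \<in> a \<longleftrightarrow> i \<in> b" for a b :: "nat set" and n
  proof -
    obtain t where t: "ternary a = (\<Sum>i<Suc n. if i \<in> a then (1/3)^i else 0) + t" "0 \<le> t"
      using ternary_split by blast
    obtain u where u: "ternary b = (\<Sum>i<Suc n. if i \<in> b then (1/3)^i else 0) + u" "u \<le> 3/2 * (1/3)^Suc n"
      using ternary_split by blast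
    have "(\<Sum>i<n. if i \<in> a then (1/3)^i else 0) = (\<Sum>i<n. if i \<in> b then (1/3)^i else 0 :: real)"
      using n(3) by (intro sum.cong) auto
    then have "ternary a - ternary b = (1/3)^n + t - u"
      using t(1) u(1) n(1,2) by simp
    moreover have "(0::real) < (1/3)^n"
      by simp
    moreover have "u \<le> (1/3)^n / 2"
      using u(2) by simp
    ultimately show ?thesis
      using t(2) by linarith
  qed
  fix a b assume eq: "ternary a = ternary b" and "a \<noteq> b"
  define n where "n = (LEAST n. (n \<in> a) \<noteq> (n \<in> b))"
  have "\<exists>n. (n \<in> a) \<noteq> (n \<in> b)"
    using \<open>a \<noteq> b\<close> by blast
  then have "(n \<in> a) \<noteq> (n \<in> b)"
    unfolding n_def by (rule LeastI_ex)
  moreover have "i \<in> a \<longleftrightarrow> i \<in> b" if "i < n" for i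
    using not_less_Least[of i "\<lambda>n. (n \<in> a) \<noteq> (n \<in> b)"] that by (simp add: n_def)
  ultimately show False
    using *[of n a b] *[of n b a] eq by auto
qed

lemma continuous_ternary: "continuous_map cantor_topology euclidean ternary"
  unfolding continuous_map_def
proof (intro conjI allI impI)
  fix U :: "real set" assume "openin euclidean U"
  then have U: "open U" by simp
  show "openin cantor_topology {x \<in> topspace cantor_topology. ternary x \<in> U}"
    unfolding openin_cantor
  proof
    fix a assume "a \<in> {x \<in> topspace cantor_topology. ternary x \<in> U}"
    then obtain r where r: "r > 0" "\<And>v. \<bar>v - ternary a\<bar> < r \<Longrightarrow> v \<in> U"
      using U unfolding open_dist dist_real_def by auto
    obtain n where n: "(1/3)^n < r / (3/2)"
      using real_arch_pow_inv[of "r / (3/2)" "1/3"] r(1) by auto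
    have "ternary x \<in> U" if x: "x \<in> cyl a n" for x
    proof -
      obtain t where t: "ternary a = (\<Sum>i<n. if i \<in> a then (1/3)^i else 0) + t" "0 \<le> t" "t \<le> 3/2 * (1/3)^n"
        using ternary_split by blast
      obtain u where u: "ternary x = (\<Sum>i<n. if i \<in> x then (1/3)^i else 0) + u" "0 \<le> u" "u \<le> 3/2 * (1/3)^n"
        using ternary_split by blast
      have "(\<Sum>i<n. if i \<in> a then (1/3)^i else 0) = (\<Sum>i<n. if i \<in> x then (1/3)^i else 0 :: real)"
        using x by (intro sum.cong) (auto simp: cyl_def)
      then have "\<bar>ternary x - ternary a\<bar> \<le> 3/2 * (1/3)^n"
        using t u by linarith
      then show ?thesis
        using n by (intro r(2)) simp
    qed
    then show "\<exists>n. cyl a n \<subseteq> {x \<in> topspace cantor_topology. ternary x \<in> U}"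
      by auto
  qed
qed auto

section \<open>Comparing domination almost everywhere with domination modulo a semifilter\<close>

lemma le_star_imp_le_on:
  assumes S: "semifilter S" and "a \<le>\<^sup>* b" "le_on S b c"
  shows "le_on S a c"
proof -
  let ?s = "{n. enumerate b n \<le> enumerate c n}" and ?t = "{n. enumerate a n \<le> enumerate c n}"
  have s: "?s \<in> S" "infinite ?s"
    using S assms(3) unfolding le_on_def semifilter_def by auto
  have "finite {n. \<not> enumerate a n \<le> enumerate b n}"
    using assms(2) unfolding le_star_def MOST_iff_finiteNeg .
  moreover have "?s - ?t \<subseteq> {n. \<not> enumerate a n \<le> enumerate b n}"
    by auto
  ultimately have fin: "finite (?s - ?t)"
    by (rule rev_finite_subset)
  then have "infinite ?t"
    using s(2) by (metis Diff_infinite_finite)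
  then show ?thesis
    using S s(1) fin unfolding semifilter_def le_on_def almost_subset_def by blast
qed

text \<open>The inequality holds on a cofinite set; such sets belong to \<open>S\<close>, and their
  finite complements do not.\<close>

lemma le_star_imp_le_on':
  assumes S: "semifilter S" and ab: "a \<le>\<^sup>* b"
  shows "le_on S a b" "le_on (semifilter_dual S) a b"
proof -
  let ?t = "{n. enumerate a n \<le> enumerate b n}"
  have fin: "finite (- ?t)"
    using ab unfolding le_star_def MOST_iff_finiteNeg by (simp add: Collect_neg_eq)
  then have inf: "infinite ?t"
    by (metis finite_compl infinite_UNIV_nat)
  obtain s where "s \<in> S"
    using S unfolding semifilter_def by blast
  moreover have "s \<subseteq>\<^sup>* ?t"
    unfolding almost_subset_def by (rule finite_subset[OF _ fin]) auto
  ultimately show "le_on S a b"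
    using S inf unfolding semifilter_def le_on_def by blast
  have "UNIV - ?t \<notin> S"
    using S fin unfolding semifilter_def Compl_eq_Diff_UNIV by blast
  then show "le_on (semifilter_dual S) a b"
    using inf unfolding le_on_def semifilter_dual_def by blast
qed

lemma bnum_le_bnum_of:
  assumes S: "semifilter S"
  shows "bnum \<le>o bnum_of S"
proof -
  obtain A where A: "unbounded_fam (le_on S) A" "bnum_of S = |A|"
    unfolding bnum_of_def using min_card_attained[of _ inf_sets] unbounded_fam_le_on[OF S] by blast
  then have "unbounded_fam (\<le>\<^sup>*) A"
    using le_star_imp_le_on'(1)[OF S] unfolding unbounded_fam_def by blast
  then show ?thesis
    unfolding A(2) by (rule bnum_le)
qed

text \<open>Removing the least element of \<open>c\<close> strictly raises its enumeration, so some
  \<open>d\<close> in \<open>D\<close> exceeds \<open>c\<close> almost everywhere, while members of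
  \<open>S\<close> are infinite. This bounds \<open>bnum_of S\<close> by
  \<open>dnum\<close>.\<close>

lemma dominating_imp_unbounded:
  assumes S: "semifilter S" and D: "dominating_fam D"
  shows "unbounded_fam (le_on S) D"
proof -
  have "\<exists>d\<in>D. \<not> le_on S d c" if c: "infinite c" for c
  proof -
    let ?c = "c - {enumerate c 0}"
    obtain d where d: "d \<in> D" "?c \<le>\<^sup>* d"
      using D shifted_enumeration(1)[OF c] unfolding dominating_fam_def by blast
    have "finite {n. \<not> enumerate ?c n \<le> enumerate d n}"
      using d(2) unfolding le_star_def MOST_iff_finiteNeg .
    moreover have "{n. enumerate d n \<le> enumerate c n} \<subseteq> {n. \<not> enumerate ?c n \<le> enumerate d n}"
      using shifted_enumeration(2)[OF c] by (auto simp: not_le intro: le_less_trans)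
    ultimately have "finite {n. enumerate d n \<le> enumerate c n}"
      by (rule rev_finite_subset)
    then have "\<not> le_on S d c"
      using S unfolding le_on_def semifilter_def by blast
    then show ?thesis
      using d(1) by blast
  qed
  then show ?thesis
    using D unfolding unbounded_fam_def dominating_fam_def by blast
qed

lemma nonmeager_imp_not_menger_product:
  assumes bd: "bnum =o dnum" and S: "semifilter S" and nm: "\<not> meager_in cantor_topology S"
  obtains X and Y :: "real set"
  where "semifilter_scale S X" "concentrated dnum (top_of_set Y)"
    "\<not> menger_space (prod_topology (subtopology cantor_topology (X \<union> fin_sets)) (top_of_set Y))"
proof -
  obtain D where D: "dominating_fam D" "dnum = |D|"
    unfolding dnum_def using min_card_attained[of _ inf_sets] dominating_fam_inf_sets by blast
  \<comment> \<open>The cardinal order on \<open>D\<close> has proper initial segments of size less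
    than \<open>dnum\<close>, hence less than \<open>bnum\<close>, so each is bounded;
    \<open>c d\<close> bounds \<open>d\<close> together with its predecessors.\<close>
  define below where "below d = underS |D| d" for d
  have below_sub: "below d \<subseteq> D" for d
    unfolding below_def using underS_Field[of _ "|D|" d] by (auto simp: Field_card_of)
  have below_card: "|below d| <o dnum" if "d \<in> D" for d
    unfolding below_def D(2) using that by (intro card_of_underS card_of_Card_order) (simp add: Field_card_of)
  have below_total: "d \<in> below e \<or> d = e \<or> e \<in> below d" if "d \<in> D" "e \<in> D" for d e
  proof -
    have "total_on D |D|"
      using card_of_Well_order[of D] by (simp add: well_order_on_def linear_order_on_def Field_card_of)
    then show ?thesis
      using that unfolding total_on_def below_def underS_def by blast
  qed
  have "\<exists>c. infinite c \<and> d \<le>\<^sup>* c \<and> (\<forall>e\<in>below d. e \<le>\<^sup>* c)" if d: "d \<in> D" for d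
  proof -
    have "|below d| <o bnum" "below d \<subseteq> inf_sets"
      using below_card[OF d] bd ordIso_symmetric ordLess_ordIso_trans below_sub[of d] D(1)
      unfolding dominating_fam_def by blast+
    then obtain b where b: "infinite b" "\<And>e. e \<in> below d \<Longrightarrow> e \<le>\<^sup>* b"
      using bounded_if_less_bnum by metis
    obtain c where c: "infinite c" "\<And>n. max (enumerate d n) (enumerate b n) \<le> enumerate c n"
      using infinite_set_above[of "\<lambda>n. max (enumerate d n) (enumerate b n)"] by metis
    then have "d \<le>\<^sup>* c" "b \<le>\<^sup>* c"
      unfolding le_star_def by simp_all
    then show ?thesis
      using b(2) c(1) le_star_trans by blast
  qed
  then obtain c where c: "\<And>d. d \<in> D \<Longrightarrow> infinite (c d)" "\<And>d. d \<in> D \<Longrightarrow> d \<le>\<^sup>* c d"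
      "\<And>d e. d \<in> D \<Longrightarrow> e \<in> below d \<Longrightarrow> e \<le>\<^sup>* c d"
    by metis
  \<comment> \<open>All exceptional sets below come from here: a property of \<open>x d\<close>
    inherited from \<open>e \<le>\<^sup>* c d\<close> can fail only for \<open>d\<close> in
    \<open>below e\<close>.\<close>
  have le_c: "e \<le>\<^sup>* c d" if "d \<in> D - below e" "e \<in> D" for d e
    using that below_total[of d e] c(2,3) by blast
  have "\<forall>d\<in>D. \<exists>x. infinite x \<and> le_on S (c d) x \<and> infinite (starts x) \<and>
      (\<forall>n. enumerate (c d) n \<le> enumerate (starts x) n) \<and> infinite (- x) \<and> \<not> - x \<le>\<^sup>* c d"
    using nonmeager_block_set[OF S nm c(1)] by metis
  from bchoice[OF this] obtain x where x: "\<And>d. d \<in> D \<Longrightarrow> infinite (x d)" "\<And>d. d \<in> D \<Longrightarrow> le_on S (c d) (x d)"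
      "\<And>d. d \<in> D \<Longrightarrow> infinite (starts (x d))"
      "\<And>d n. d \<in> D \<Longrightarrow> enumerate (c d) n \<le> enumerate (starts (x d)) n"
      "\<And>d. d \<in> D \<Longrightarrow> infinite (- x d)" "\<And>d. d \<in> D \<Longrightarrow> \<not> - x d \<le>\<^sup>* c d"
    by auto
  define X where "X = x ` D"
  have cstarts: "c d \<le>\<^sup>* starts (x d)" if "d \<in> D" for d
    using x(4)[OF that] by (simp add: le_star_def)
  have dX: "dnum \<le>o |X|"
  proof -
    have "dominating_fam (starts ` X)"
      unfolding dominating_fam_def
    proof (intro conjI ballI)
      show "starts ` X \<subseteq> inf_sets"
        using x(3) by (auto simp: X_def)
      fix a assume "a \<in> inf_sets"
      then obtain d where "d \<in> D" "a \<le>\<^sup>* d"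
        using D(1) unfolding dominating_fam_def by blast
      then have "a \<le>\<^sup>* starts (x d)"
        using c(2) cstarts le_star_trans by blast
      then show "\<exists>e\<in>starts ` X. a \<le>\<^sup>* e"
        using \<open>d \<in> D\<close> by (auto simp: X_def)
    qed
    then show ?thesis
      using dnum_le card_of_image ordLeq_transitive by blast
  qed
  have bS1: "dnum \<le>o bnum_of S"
    using bnum_le_bnum_of[OF S] bd ordIso_ordLeq_trans ordIso_symmetric by blast
  have bS2: "bnum_of S \<le>o dnum"
    unfolding D(2) by (intro bnum_of_le S dominating_imp_unbounded D(1))
  have scale: "semifilter_scale S X"
    unfolding semifilter_scale_def
  proof (intro conjI ballI)
    show "X \<subseteq> inf_sets"
      using x(1) by (auto simp: X_def)
    show "bnum_of S \<le>o |X|"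
      using bS2 dX ordLeq_transitive by blast
    fix b assume "b \<in> inf_sets"
    \<comment> \<open>The member \<open>e\<close> of the dominating family above \<open>b\<close> is
      the witness required of a scale.\<close>
    then obtain e where e: "e \<in> D" "b \<le>\<^sup>* e"
      using D(1) unfolding dominating_fam_def by blast
    have "{y \<in> X. \<not> le_on S e y} \<subseteq> x ` below e"
    proof
      fix y assume "y \<in> {y \<in> X. \<not> le_on S e y}"
      then obtain d where d: "d \<in> D" "y = x d" "\<not> le_on S e (x d)"
        unfolding X_def by blast
      then have "d \<in> below e"
        using le_star_imp_le_on[OF S le_c] e(1) x(2) by blast
      then show "y \<in> x ` below e"
        using d(2) by blast
    qed
    then have "|{y \<in> X. \<not> le_on S e y}| \<le>o |x ` below e|"
      by (rule card_of_mono1)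
    then have "|{y \<in> X. \<not> le_on S e y}| <o bnum_of S"
      using image_less_card[OF below_card[OF e(1)], of x] bS1 ordLeq_ordLess_trans ordLess_ordLeq_trans
      by blast
    moreover have "e \<in> inf_sets"
      using D(1) e(1) unfolding dominating_fam_def by blast
    ultimately show "\<exists>c\<in>inf_sets. le_on (semifilter_dual S) b c \<and> |{x \<in> X. \<not> le_on S c x}| <o bnum_of S"
      using le_star_imp_le_on'(2)[OF S e(2)] by blast
  qed
  define Q where "Q = ternary ` {a. finite (- a)}"
  define Y where "Y = ternary ` (X \<union> {a. finite (- a)})"
  have "concentrated dnum (top_of_set Y)"
    unfolding concentrated_def topspace_euclidean_subtopology
  proof (intro conjI exI[of _ Q] allI impI)
    have "|X| \<le>o |Y|"
    proof (rule card_of_ordLeq[THEN iffD1], intro exI conjI)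
      show "inj_on ternary X"
        using inj_ternary by (rule inj_on_subset) simp
    qed (auto simp: Y_def)
    then show "dnum \<le>o |Y|"
      using dX ordLeq_transitive by blast
    have "{a. finite (- a)} = uminus ` fin_sets"
      by (auto simp: image_iff)
    then show "countable Q"
      unfolding Q_def using countable_Collect_finite[where 'a = nat] by simp
    show "Q \<subseteq> Y"
      by (auto simp: Q_def Y_def)
    fix U assume U: "openin (top_of_set Y) U \<and> Q \<subseteq> U"
    then obtain V where V: "open V" "U = Y \<inter> V"
      unfolding openin_open by blast
    have op: "openin cantor_topology {a. ternary a \<in> V}"
      using openin_continuous_map_preimage[OF continuous_ternary, of V] V(1) by simp
    have cof: "a \<in> {a. ternary a \<in> V}" if "finite (- a)" for a
      using that U V(2) by (auto simp: Q_def)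
    obtain u where u: "infinite u" "\<And>a. infinite (- a) \<Longrightarrow> ternary a \<notin> V \<Longrightarrow> - a \<le>\<^sup>* u"
      using open_superset_of_cofinite[OF op cof] by (metis (no_types, lifting) mem_Collect_eq)
    obtain e where e: "e \<in> D" "u \<le>\<^sup>* e"
      using D(1) u(1) unfolding dominating_fam_def by blast
    have "Y - U \<subseteq> (\<lambda>d. ternary (x d)) ` below e"
    proof
      fix y assume "y \<in> Y - U"
      then obtain a where a: "y = ternary a" "ternary a \<notin> V" "a \<in> X \<union> {a. finite (- a)}"
        unfolding Y_def V(2) by blast
      then have "a \<in> X"
        using cof by blast
      then obtain d where d: "d \<in> D" "a = x d"
        by (auto simp: X_def)
      \<comment> \<open>If \<open>d\<close> were not in \<open>below e\<close>, then
        \<open>e \<le>\<^sup>* c d\<close> would contradict the long gaps of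
        \<open>- x d\<close>.\<close>
      have "- x d \<le>\<^sup>* e"
        using u(2)[of a] x(5)[OF d(1)] a(2) d(2) e(2) le_star_trans by blast
      then have "d \<in> below e"
        using le_c[of d e] d(1) e(1) x(6)[OF d(1)] le_star_trans by blast
      then show "y \<in> (\<lambda>d. ternary (x d)) ` below e"
        using a(1) d(2) by blast
    qed
    then have "|Y - U| \<le>o |(\<lambda>d. ternary (x d)) ` below e|"
      by (rule card_of_mono1)
    then show "|Y - U| <o dnum"
      using image_less_card[OF below_card[OF e(1)]] ordLeq_ordLess_trans by blast
  qed
  moreover have "\<not> menger_space (prod_topology (subtopology cantor_topology (X \<union> fin_sets)) (top_of_set Y))"
      (is "\<not> menger_space ?T")
  proof
    assume M: "menger_space ?T"
    have top: "topspace ?T = (X \<union> fin_sets) \<times> Y"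
      by simp
    \<comment> \<open>The first part is the complement of the diagonal. On the diagonal, membership
      in \<open>W n m\<close> says that the start with index \<open>n\<close> is below
      \<open>m\<close>, so a selection would have to exceed the starts of each \<open>x d\<close>
      infinitely often.\<close>
    define W where "W n m = {z \<in> topspace ?T. snd z \<noteq> ternary (fst z)} \<union>
      {z \<in> topspace ?T. n < card (starts (fst z) \<inter> {..<m})}" for n m
    have fst: "continuous_map ?T cantor_topology fst"
      using continuous_map_fst continuous_map_into_fulltopology by blast
    have snd: "continuous_map ?T euclidean snd"
      using continuous_map_snd continuous_map_into_fulltopology by blast
    have "closedin ?T {z \<in> topspace ?T. snd z = (ternary \<circ> fst) z}"
      by (intro closedin_continuous_maps_eq[of euclidean] snd continuous_map_compose[OF fst continuous_ternary]) simp
    then have "openin ?T (topspace ?T - {z \<in> topspace ?T. snd z = (ternary \<circ> fst) z})"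
      by (rule openin_diff[OF openin_topspace])
    moreover have "topspace ?T - {z \<in> topspace ?T. snd z = (ternary \<circ> fst) z} =
        {z \<in> topspace ?T. snd z \<noteq> ternary (fst z)}"
      by auto
    ultimately have op1: "openin ?T {z \<in> topspace ?T. snd z \<noteq> ternary (fst z)}"
      by simp
    have "openin ?T {z \<in> topspace ?T. n < card (starts (fst z) \<inter> {..<m})}" for n m
      using openin_continuous_map_preimage[OF fst openin_starts[of n m]] by simp
    then have op: "openin ?T (W n m)" for n m
      unfolding W_def using op1 by (intro openin_Un)
    have mono: "mono (W n)" for n
    proof (rule monoI)
      fix m m' :: nat assume "m \<le> m'"
      then have "card (starts a \<inter> {..<m}) \<le> card (starts a \<inter> {..<m'})" for a
        by (intro card_mono) auto
      then show "W n m \<le> W n m'"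
        unfolding W_def by (auto intro: less_le_trans)
    qed
    have cover: "topspace ?T \<subseteq> (\<Union>m. W n m)" for n
    proof
      fix z assume z: "z \<in> topspace ?T"
      show "z \<in> (\<Union>m. W n m)"
      proof (cases "snd z = ternary (fst z)")
        case True
        then have "ternary (fst z) \<in> ternary ` (X \<union> {a. finite (- a)})"
          using z by (auto simp: top Y_def mem_Times_iff)
        then have "fst z \<in> X \<union> {a. finite (- a)}"
          unfolding inj_image_mem_iff[OF inj_ternary] .
        moreover have "fst z \<in> X \<union> fin_sets"
          using z by (auto simp: top)
        \<comment> \<open>A point of the diagonal outside \<open>X\<close> would be both finite and
          cofinite.\<close>
        ultimately have "fst z \<in> X"
          by (metis Un_iff finite_compl infinite_UNIV_nat mem_Collect_eq)
        then have "infinite (starts (fst z))"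
          using x(3) by (auto simp: X_def)
        then have "n < card (starts (fst z) \<inter> {..<Suc (enumerate (starts (fst z)) n)})"
          by (simp flip: enumerate_less_iff)
        then show ?thesis
          using z unfolding W_def by blast
      qed (use z in \<open>auto simp: W_def\<close>)
    qed
    obtain g where g: "\<And>z. z \<in> topspace ?T \<Longrightarrow> \<exists>\<^sub>\<infinity>n. z \<in> W n (g n)"
      using menger_space_imp_selectable[where W = W, OF M op mono cover] unfolding selectable_def by blast
    obtain b where b: "infinite b" "\<And>n. g n \<le> enumerate b n"
      using infinite_set_above by metis
    obtain d where d: "d \<in> D" "b \<le>\<^sup>* d"
      using D(1) b(1) unfolding dominating_fam_def by blast
    have "(x d, ternary (x d)) \<in> topspace ?T"
      using d(1) by (auto simp: top X_def Y_def)
    then have "\<exists>\<^sub>\<infinity>n. (x d, ternary (x d)) \<in> W n (g n)"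
      by (rule g)
    moreover have "b \<le>\<^sup>* starts (x d)"
      using d c(2) cstarts le_star_trans by blast
    ultimately have "\<exists>\<^sub>\<infinity>n. (x d, ternary (x d)) \<in> W n (g n) \<and> enumerate b n \<le> enumerate (starts (x d)) n"
      unfolding le_star_def by (rule INFM_conjI)
    then obtain n where n: "(x d, ternary (x d)) \<in> W n (g n)" "enumerate b n \<le> enumerate (starts (x d)) n"
      using INFM_EX by blast
    then have "n < card (starts (x d) \<inter> {..<g n})"
      by (auto simp: W_def)
    then have "enumerate (starts (x d)) n < g n"
      using x(3)[OF d(1)] by (simp add: enumerate_less_iff)
    then show False
      using n(2) b(2)[of n] by simp
  qed
  ultimately show ?thesis
    using that scale by blast
qed

theorem theorem4p7:
  fixes S :: "nat set set"
  assumes "bnum =o dnum"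
    and "semifilter S"
  shows "\<not> meager_in cantor_topology S \<longleftrightarrow>
    (\<exists>(X :: nat set set) (Y :: real set).
       semifilter_scale S X \<and> concentrated dnum (top_of_set Y) \<and>
       \<not> menger_space
          (prod_topology (subtopology cantor_topology (X \<union> fin_sets)) (top_of_set Y)))"
  using meager_imp_menger_product[OF assms] nonmeager_imp_not_menger_product[OF assms] by metis

end
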